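(* Let $\Sigma\subset B_{2R}(0)\subset\mathbb R^{n+1}$, with $\partial\Sigma\subset\partial B_{2R}(0)$, be a two-sided, smooth, properly immersed hypersurface satisfying $H=\tfrac12\langle x,N\rangle+C$ for some constant $C$ and the stability condition $$-\int_\Sigma u\,Lu\,d\mathcal A_\mu\ge0\quad\text{for all }u\in C_0^\infty(\Sigma)\text{ with }\int_\Sigma u\,d\mathcal A_\mu=0.$$ If $\mathcal A_\mu(\Sigma\cap B_R)\ge2B_nR^{-2}\mathcal A_\mu(\Sigma\cap(B_{2R}\setminus B_R))$, then $$\int_{B_R\cap\Sigma}|A|^2\,d\mathcal A_\mu\le2B_nR^{-2}\,\mathcal A_\mu(\Sigma\cap(B_{2R}\setminus B_R)).$$
   Context: $R>0$; $B_r=B_r(0)=\{x\in\mathbb R^{n+1}:|x|\le r\}$. $N$ is the chosen unit normal ($\Sigma$ need not be connected), $x$ the position vector, $x^T$ its tangential part, $A(X,Y)=\langle\nabla_XN,Y\rangle$ the second fundamental form, $|A|$ its norm, $H=\operatorname{div}N$ the mean curvature. $d\mathcal A_\mu=e^{-|x|^2/4}\,d\mathcal A$ with $d\mathcal A$ the area measure on $\Sigma$ induced by the immersion; $\Sigma\cap B_r$ denotes the set of points of $\Sigma$ whose position lies in $B_r$. $Lu=\triangle u-\tfrac12\nabla_{x^T}u+|A|^2u+\tfrac12u$, with $\triangle,\nabla$ in the induced metric. $C_0^\infty(\Sigma)$ denotes smooth functions compactly supported in the interior of $\Sigma$. $B_n$ denotes a fixed constant depending only on $n$ for which the following holds: for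 every two-sided, smooth, immersed hypersurface $\Sigma\subset\mathbb R^{n+1}$ satisfying $H=\tfrac12\langle x,N\rangle+C$ for some constant $C$ and the stability condition above, and every $\phi\in C_0^\infty(\Sigma)$ with $\phi\ge0$, $\phi\not\equiv0$, one has $$\int_\Sigma\phi^2|N-N_\phi|^2\,d\mathcal A_\mu+|N_\phi|^2\int_\Sigma\phi^2|A|^2\,d\mathcal A_\mu\le B_n\int_\Sigma|\nabla\phi|^2\,d\mathcal A_\mu,\qquad N_\phi=\frac{\int_\Sigma\phi N\,d\mathcal A_\mu}{\int_\Sigma\phi\,d\mathcal A_\mu}\in\mathbb R^{n+1}.$$ *)

theory Defs
  imports "HOL-Analysis.Analysis"
begin

section \<open>Smooth maps\<close>

text \<open>\<open>Ck_on k U f\<close> is the usual \<open>C\<^sup>k\<close> property and is meant for open \<open>U\<close> only.\<close>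

primrec Ck_on :: "nat \<Rightarrow> 'a::real_normed_vector set \<Rightarrow> ('a \<Rightarrow> 'b::real_normed_vector) \<Rightarrow> bool" where
  "Ck_on 0 U f \<longleftrightarrow> continuous_on U f"
| "Ck_on (Suc k) U f \<longleftrightarrow>
     f differentiable_on U \<and> (\<forall>v. Ck_on k U (\<lambda>x. frechet_derivative f (at x) v))"

text \<open>Smoothness on an arbitrary set: local extendability to a smooth map on an open set.\<close>

definition smooth_on :: "'a::real_normed_vector set \<Rightarrow> ('a \<Rightarrow> 'b::real_normed_vector) \<Rightarrow> bool" where
  "smooth_on A f \<longleftrightarrow>
     (\<forall>a\<in>A. \<exists>U g. open U \<and> a \<in> U \<and> (\<forall>k. Ck_on k U g) \<and> (\<forall>x\<in>A \<inter> U. g x = f x))"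


section \<open>Two-sided immersed hypersurfaces with boundary\<close>

text \<open>
  Here \<open>n = CARD('n)\<close>, and \<open>real ^ ('n + 1)\<close> is Euclidean space of dimension \<open>n + 1\<close>.
  The data are an abstract space \<open>surf S\<close>, an atlas given by local parametrizations
  \<open>(V, \<psi>)\<close> (inverses of charts, \<open>\<psi>\<close> being relevant on \<open>V\<close> only),
  the immersion \<open>pos S\<close> (position vector) and the chosen unit normal \<open>nrm S\<close>.
\<close>

record ('m, 'n) hypersurface =
  surf :: "'m topology"
  params :: "((real ^ 'n::finite) set \<times> (real ^ 'n \<Rightarrow> 'm)) set"
  pos :: "'m \<Rightarrow> real ^ ('n + 1)"
  nrm :: "'m \<Rightarrow> real ^ ('n + 1)"

text \<open>
  Parameter domains are relatively open in some closed coordinate half-space, so that boundary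
  points are allowed.  Near such boundary points derivatives are taken within the domain,
  where they are still unique.
\<close>

definition smooth_manifold :: "('m, 'n::finite) hypersurface \<Rightarrow> bool" where
  "smooth_manifold S \<longleftrightarrow>
     Hausdorff_space (surf S) \<and> second_countable (surf S) \<and>
     (\<Union>(V, \<psi>)\<in>params S. \<psi> ` V) = topspace (surf S) \<and>
     (\<forall>(V, \<psi>)\<in>params S.
        (\<exists>k. openin (top_of_set {y. 0 \<le> y $ k}) V) \<and>
        openin (surf S) (\<psi> ` V) \<and>
        homeomorphic_map (top_of_set V) (subtopology (surf S) (\<psi> ` V)) \<psi>) \<and>
     (\<forall>(V, \<psi>)\<in>params S. \<forall>(W, \<theta>)\<in>params S.
        smooth_on (V \<inter> \<psi> -` (\<theta> ` W)) (the_inv_into W \<theta> \<circ> \<psi>))"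

definition surf_interior :: "('m, 'n::finite) hypersurface \<Rightarrow> 'm set" where
  "surf_interior S = (\<Union>(V, \<psi>)\<in>params S. \<psi> ` interior V)"

definition surf_boundary :: "('m, 'n::finite) hypersurface \<Rightarrow> 'm set" where
  "surf_boundary S = topspace (surf S) - surf_interior S"

definition smooth_fun :: "('m, 'n::finite) hypersurface \<Rightarrow> ('m \<Rightarrow> 'b::real_normed_vector) \<Rightarrow> bool" where
  "smooth_fun S f \<longleftrightarrow> (\<forall>(V, \<psi>)\<in>params S. smooth_on V (f \<circ> \<psi>))"

definition immersed_hypersurface :: "('m, 'n::finite) hypersurface \<Rightarrow> bool" where
  "immersed_hypersurface S \<longleftrightarrow>
     smooth_manifold S \<and> smooth_fun S (pos S) \<and>
     (\<forall>(V, \<psi>)\<in>params S. \<forall>y\<in>V. inj (frechet_derivative (pos S \<circ> \<psi>) (at y within V)))"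

definition two_sided :: "('m, 'n::finite) hypersurface \<Rightarrow> bool" where
  "two_sided S \<longleftrightarrow>
     smooth_fun S (nrm S) \<and>
     (\<forall>p\<in>topspace (surf S). norm (nrm S p) = 1) \<and>
     (\<forall>(V, \<psi>)\<in>params S. \<forall>y\<in>V. \<forall>w.
        nrm S (\<psi> y) \<bullet> frechet_derivative (pos S \<circ> \<psi>) (at y within V) w = 0)"

text \<open>Smooth functions with compact support in the interior.\<close>

definition test_fun :: "('m, 'n::finite) hypersurface \<Rightarrow> ('m \<Rightarrow> real) \<Rightarrow> bool" where
  "test_fun S u \<longleftrightarrow>
     smooth_fun S u \<and>
     compactin (surf S) (surf S closure_of {p \<in> topspace (surf S). u p \<noteq> 0}) \<and>
     surf S closure_of {p \<in> topspace (surf S). u p \<noteq> 0} \<subseteq> surf_interior S"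


section \<open>Area measure\<close>

definition gram_det :: "('m, 'n::finite) hypersurface \<Rightarrow> (real ^ 'n) set \<Rightarrow> (real ^ 'n \<Rightarrow> 'm) \<Rightarrow> real ^ 'n \<Rightarrow> real" where
  "gram_det S V \<psi> y =
     (let D = frechet_derivative (pos S \<circ> \<psi>) (at y within V)
      in det (\<chi> i j. D (axis i 1) \<bullet> D (axis j 1)))"

text \<open>
  The unique Borel measure that is \<open>sqrt (det g) dy\<close> in every local parametrization,
  \<open>g\<close> being the induced metric.
\<close>

definition area :: "('m, 'n::finite) hypersurface \<Rightarrow> 'm measure" where
  "area S = (THE m.
     space m = topspace (surf S) \<and>
     sets m = sigma_sets (topspace (surf S)) {U. openin (surf S) U} \<and>
     (\<forall>(V, \<psi>)\<in>params S. \<forall>E\<in>sets m. E \<subseteq> \<psi> ` V \<longrightarrow>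
        emeasure m E = (\<integral>\<^sup>+ y\<in>V \<inter> \<psi> -` E. ennreal (sqrt (gram_det S V \<psi> y)) \<partial>lborel)))"

definition garea :: "('m, 'n::finite) hypersurface \<Rightarrow> 'm measure" where
  "garea S = density (area S) (\<lambda>p. ennreal (exp (- (norm (pos S p))\<^sup>2 / 4)))"

text \<open>The points of the hypersurface whose position lies in \<open>A\<close>.\<close>

definition part_in :: "('m, 'n::finite) hypersurface \<Rightarrow> (real ^ ('n + 1)) set \<Rightarrow> 'm set" where
  "part_in S A = {p \<in> topspace (surf S). pos S p \<in> A}"


section \<open>Differential operators and curvature\<close>

text \<open>
  Derivatives at \<open>p\<close> are computed in an arbitrarily selected parametrization around \<open>p\<close>;
  the derivative of \<open>f\<close> along a tangent vector \<open>v\<close>, viewed as a vector of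
  the ambient space, does not depend on the selection.
\<close>

definition param_at :: "('m, 'n::finite) hypersurface \<Rightarrow> 'm \<Rightarrow> (real ^ 'n) set \<times> (real ^ 'n \<Rightarrow> 'm)" where
  "param_at S p = (SOME (V, \<psi>). (V, \<psi>) \<in> params S \<and> p \<in> \<psi> ` V)"

definition coord_deriv ::
    "('m, 'n::finite) hypersurface \<Rightarrow> ('m \<Rightarrow> 'b::real_normed_vector) \<Rightarrow> 'm \<Rightarrow> real ^ 'n \<Rightarrow> 'b" where
  "coord_deriv S f p =
     (case param_at S p of (V, \<psi>) \<Rightarrow>
        frechet_derivative (f \<circ> \<psi>) (at (the_inv_into V \<psi> p) within V))"

definition tangent_space :: "('m, 'n::finite) hypersurface \<Rightarrow> 'm \<Rightarrow> (real ^ ('n + 1)) set" where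
  "tangent_space S p = range (coord_deriv S (pos S) p)"

definition dir_deriv ::
    "('m, 'n::finite) hypersurface \<Rightarrow> real ^ ('n + 1) \<Rightarrow> ('m \<Rightarrow> 'b::real_normed_vector) \<Rightarrow> 'm \<Rightarrow> 'b" where
  "dir_deriv S v f p = coord_deriv S f p (the_inv (coord_deriv S (pos S) p) v)"

definition tangent_onb :: "('m, 'n::finite) hypersurface \<Rightarrow> 'm \<Rightarrow> (real ^ ('n + 1)) set" where
  "tangent_onb S p =
     (SOME E. pairwise orthogonal E \<and> (\<forall>e\<in>E. norm e = 1) \<and> span E = tangent_space S p)"

definition tangential :: "('m, 'n::finite) hypersurface \<Rightarrow> 'm \<Rightarrow> real ^ ('n + 1) \<Rightarrow> real ^ ('n + 1)" where
  "tangential S p v = (\<Sum>e\<in>tangent_onb S p. (v \<bullet> e) *\<^sub>R e)"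

definition surf_grad :: "('m, 'n::finite) hypersurface \<Rightarrow> ('m \<Rightarrow> real) \<Rightarrow> 'm \<Rightarrow> real ^ ('n + 1)" where
  "surf_grad S u p = (\<Sum>e\<in>tangent_onb S p. dir_deriv S e u p *\<^sub>R e)"

text \<open>
  Divergence along the hypersurface of a vector field with values in the ambient space.  For a
  tangential field this is the divergence of the Levi-Civita connection of the induced metric,
  which is the tangential part of the ambient derivative.
\<close>

definition surf_div :: "('m, 'n::finite) hypersurface \<Rightarrow> ('m \<Rightarrow> real ^ ('n + 1)) \<Rightarrow> 'm \<Rightarrow> real" where
  "surf_div S Y p = (\<Sum>e\<in>tangent_onb S p. dir_deriv S e Y p \<bullet> e)"

definition laplacian :: "('m, 'n::finite) hypersurface \<Rightarrow> ('m \<Rightarrow> real) \<Rightarrow> 'm \<Rightarrow> real" where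
  "laplacian S u p = surf_div S (surf_grad S u) p"

definition second_ff :: "('m, 'n::finite) hypersurface \<Rightarrow> 'm \<Rightarrow> real ^ ('n + 1) \<Rightarrow> real ^ ('n + 1) \<Rightarrow> real" where
  "second_ff S p v w = dir_deriv S v (nrm S) p \<bullet> w"

definition norm_A :: "('m, 'n::finite) hypersurface \<Rightarrow> 'm \<Rightarrow> real" where
  "norm_A S p = sqrt (\<Sum>e\<in>tangent_onb S p. \<Sum>e'\<in>tangent_onb S p. (second_ff S p e e')\<^sup>2)"

definition mean_curv :: "('m, 'n::finite) hypersurface \<Rightarrow> 'm \<Rightarrow> real" where
  "mean_curv S p = surf_div S (nrm S) p"


section \<open>Gaussian constant mean curvature equation and stability\<close>

definition gaussian_cmc :: "('m, 'n::finite) hypersurface \<Rightarrow> bool" where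
  "gaussian_cmc S \<longleftrightarrow>
     (\<exists>C. \<forall>p\<in>topspace (surf S). mean_curv S p = 1 / 2 * (pos S p \<bullet> nrm S p) + C)"

definition L_op :: "('m, 'n::finite) hypersurface \<Rightarrow> ('m \<Rightarrow> real) \<Rightarrow> 'm \<Rightarrow> real" where
  "L_op S u p =
     laplacian S u p - 1 / 2 * dir_deriv S (tangential S p (pos S p)) u p
     + (norm_A S p)\<^sup>2 * u p + 1 / 2 * u p"

definition gaussian_stable :: "('m, 'n::finite) hypersurface \<Rightarrow> bool" where
  "gaussian_stable S \<longleftrightarrow>
     (\<forall>u. test_fun S u \<and> (\<integral>p. u p \<partial>garea S) = 0 \<longrightarrow>
        - (\<integral>p. u p * L_op S u p \<partial>garea S) \<ge> 0)"

definition avg_normal :: "('m, 'n::finite) hypersurface \<Rightarrow> ('m \<Rightarrow> real) \<Rightarrow> real ^ ('n + 1)" where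
  "avg_normal S \<phi> = (\<integral>p. \<phi> p *\<^sub>R nrm S p \<partial>garea S) /\<^sub>R (\<integral>p. \<phi> p \<partial>garea S)"

text \<open>
  The property defining the constant \<open>B\<^sub>n\<close>.  The type argument fixes the dimension
  \<open>n = CARD('n)\<close> and the type \<open>'m\<close> from which the points of the abstract hypersurfaces
  are taken.
\<close>

definition stability_const :: "('m, 'n::finite) hypersurface itself \<Rightarrow> real \<Rightarrow> bool" where
  "stability_const (T :: ('m, 'n) hypersurface itself) B \<longleftrightarrow>
     (\<forall>(S :: ('m, 'n) hypersurface) \<phi>.
        immersed_hypersurface S \<and> two_sided S \<and> gaussian_cmc S \<and> gaussian_stable S \<and>
        test_fun S \<phi> \<and> (\<forall>p\<in>topspace (surf S). \<phi> p \<ge> 0) \<and> (\<exists>p\<in>topspace (surf S). \<phi> p \<noteq> 0) \<longrightarrow>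
        (\<integral>p. (\<phi> p)\<^sup>2 * (norm (nrm S p - avg_normal S \<phi>))\<^sup>2 \<partial>garea S)
        + (norm (avg_normal S \<phi>))\<^sup>2 * (\<integral>p. (\<phi> p)\<^sup>2 * (norm_A S p)\<^sup>2 \<partial>garea S)
        \<le> B * (\<integral>p. (norm (surf_grad S \<phi> p))\<^sup>2 \<partial>garea S))"

end

theory Submission
  imports Defs
begin

text \<open>
  Insert into the defining inequality of \<open>B\<close> a cutoff \<open>\<phi> = F \<circ> pos\<close> with \<open>\<phi> = 1\<close> on \<open>B\<^sub>R\<close>, compact support in the
  open ball of radius \<open>2R\<close> and \<open>|\<nabla>\<phi>| \<le> c\<close>, where \<open>c > 1/R\<close> is arbitrary.  With \<open>a = |N\<^sub>\<phi>|\<close>, the areas \<open>m\<close> of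
  \<open>\<Sigma> \<inter> B\<^sub>R\<close> and \<open>M\<close> of the annular part, and \<open>q\<close> the integral of \<open>|A|\<^sup>2\<close> over \<open>\<Sigma> \<inter> B\<^sub>R\<close>, the bound
  \<open>|N - N\<^sub>\<phi>| \<ge> |1 - a|\<close> gives \<open>(1 - a)\<^sup>2 m + a\<^sup>2 q \<le> B c\<^sup>2 M\<close>.  This is a quadratic inequality for \<open>a\<close>, so its
  discriminant is nonnegative: \<open>(q + m) (m - B c\<^sup>2 M) \<le> m\<^sup>2\<close>.  For \<open>c \<rightarrow> 1/R\<close> and \<open>K = B M / R\<^sup>2\<close> one
  obtains \<open>q (m - K) \<le> m K\<close>, and \<open>m \<ge> 2 K\<close> yields \<open>q \<le> 2 K\<close>.

  Properness makes \<open>\<Sigma>\<close> compact.  The sign \<open>B \<ge> 0\<close> is needed as well; it follows from any test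
  function with nonvanishing gradient.
\<close>

section \<open>Change of variables\<close>

text \<open>\<open>area\<close> is a definite description, so nothing can be said about it before a
  measure with the prescribed density in every chart is shown to exist and to be unique; change of
  variables and gluing over charts serve this end. Bochner integrals of nonintegrable functions are
  0 by convention, so integrability has to be secured for every term; continuity of |A|^2 on the
  compact surface is proved for that purpose. The number c stays strictly above 1/R because a test
  function has its support in the interior while the boundary lies on the sphere of radius 2R. The
  cutoff falls from 1 to 0 over a distance strictly less than R, so the slope 1/R can only be
  approached. The size a of the averaged normal is not controlled. For a near 1 the second term
  bounds the integral of |A|^2; for a near 0 the first term is almost m, which for m > 0 is too
  large under the area hypothesis. The discriminant treats all a at once.\<close>

text \<open>The library has the change of variables formula for well-ordered index types only; it is
  transferred to an arbitrary finite index type along a well-ordered copy.\<close>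

typedef 'a wo = "UNIV :: 'a set" ..

instance wo :: (finite) finite
proof
  have "(UNIV :: 'a wo set) = Abs_wo ` UNIV"
    by (metis Rep_wo_inverse surjI)
  then show "finite (UNIV :: 'a wo set)"
    by (metis finite finite_imageI)
qed

text \<open>Only the existence of some well-order matters, so the order of the naturals is pulled
  back along an arbitrary injection.\<close>

definition wo_index :: "'a::finite wo \<Rightarrow> nat" where
  "wo_index = (SOME f. inj f)"

lemma inj_wo_index: "inj wo_index"
proof -
  obtain f :: "'a wo \<Rightarrow> nat" where "inj f"
    using finite_imp_inj_to_nat_seg[of "UNIV :: 'a wo set"] by auto
  then show ?thesis
    unfolding wo_index_def by (rule someI[of inj])
qed

instantiation wo :: (finite) wellorder
begin

definition less_eq_wo :: "'a wo \<Rightarrow> 'a wo \<Rightarrow> bool" where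
  "x \<le> y \<longleftrightarrow> wo_index x \<le> wo_index y"

definition less_wo :: "'a wo \<Rightarrow> 'a wo \<Rightarrow> bool" where
  "x < y \<longleftrightarrow> wo_index x < wo_index y"

instance
proof
  fix x y z :: "'a wo" and P :: "'a wo \<Rightarrow> bool"
  show "x < y \<longleftrightarrow> x \<le> y \<and> \<not> y \<le> x" "x \<le> x" "x \<le> y \<or> y \<le> x"
    by (auto simp: less_eq_wo_def less_wo_def)
  show "x \<le> y \<Longrightarrow> y \<le> z \<Longrightarrow> x \<le> z"
    by (auto simp: less_eq_wo_def)
  show "x \<le> y \<Longrightarrow> y \<le> x \<Longrightarrow> x = y"
    using inj_wo_index by (auto simp: less_eq_wo_def inj_def)
  show "P x" if "\<And>x. (\<And>y. y < x \<Longrightarrow> P y) \<Longrightarrow> P x"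
    using that unfolding less_wo_def by (induction x rule: measure_induct_rule[of wo_index]) blast
qed

end

text \<open>Conjugation with \<open>f\<close> is a bijection between the permutations of the two
  index types and preserves signs, so the Leibniz sums agree term by term.\<close>

lemma det_reindex:
  fixes A :: "'a::comm_ring_1 ^ 'n::finite ^ 'n" and f :: "'m::finite \<Rightarrow> 'n"
  assumes "bij f"
  shows "det (\<chi> i j. A $ f i $ f j) = det A"
proof -
  have inv: "inv f (f x) = x" "f (inv f y) = y" for x y
    using assms by (simp_all add: bij_is_inj bij_is_surj surj_f_inv_f)
  define h where "h p = f \<circ> p \<circ> inv f" for p :: "'m \<Rightarrow> 'm"
  \<comment> \<open>Conjugation turns the transposition of \<open>a\<close> and \<open>b\<close>
    into that of \<open>f a\<close> and \<open>f b\<close>, so the number of transpositions, and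
    with it the parity, is kept.\<close>
  have swap: "swapidseq n (h p)" if "swapidseq n p" for n p
    using that
  proof induction
    case id
    have "h id = id" by (auto simp: h_def inv)
    then show ?case by (metis swapidseq.id)
  next
    case (comp_Suc n p a b)
    have "h (Transposition.transpose a b \<circ> p) = Transposition.transpose (f a) (f b) \<circ> h p"
      using inv(1) assms by (auto simp: h_def fun_eq_iff inv(2) bij_def inj_eq Transposition.transpose_def)
    moreover have "f a \<noteq> f b" using comp_Suc inv by metis
    ultimately show ?case
      using comp_Suc swapidseq.comp_Suc by metis
  qed
  have sgn: "sign (h p) = sign p" if p: "p permutes UNIV" for p
  proof -
    obtain n where n: "swapidseq n p"
      using p unfolding permutation_def[symmetric] permutation_permutes by (metis finite permutation_def permutation_permutes)
    show ?thesis
      using evenperm_unique[OF n refl] evenperm_unique[OF swap[OF n] refl]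
      by (simp add: sign_def)
  qed
  have bij: "bij_betw h {p. p permutes UNIV} {p. p permutes UNIV}"
  proof (rule bij_betw_byWitness[where f' = "\<lambda>q. inv f \<circ> q \<circ> f"])
    have "bij (inv f)" using assms by (rule bij_imp_bij_inv)
    then show "h ` {p. p permutes UNIV} \<subseteq> {p. p permutes UNIV}"
      "(\<lambda>q. inv f \<circ> q \<circ> f) ` {p. p permutes UNIV} \<subseteq> {p. p permutes UNIV}"
      using assms by (auto simp: h_def intro!: bij_imp_permutes bij_comp dest: permutes_bij)
  qed (auto simp: h_def fun_eq_iff inv)
  have "det A = (\<Sum>p | p permutes UNIV. of_int (sign (h p)) * (\<Prod>i\<in>UNIV. A $ i $ h p i))"
    unfolding det_def by (rule sum.reindex_bij_betw[OF bij, symmetric])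
  also have "\<dots> = (\<Sum>p | p permutes UNIV. of_int (sign p) * (\<Prod>i\<in>UNIV. A $ f i $ f (p i)))"
  proof (intro sum.cong refl)
    fix p :: "'m \<Rightarrow> 'm" assume "p \<in> {p. p permutes UNIV}"
    moreover have "(\<Prod>i\<in>UNIV. A $ i $ h p i) = (\<Prod>i\<in>UNIV. A $ f i $ f (p i))"
      using prod.reindex_bij_betw[OF assms, of "\<lambda>i. A $ i $ h p i"] by (simp add: h_def inv)
    ultimately show "of_int (sign (h p)) * (\<Prod>i\<in>UNIV. A $ i $ h p i) =
        of_int (sign p) * (\<Prod>i\<in>UNIV. A $ f i $ f (p i))"
      by (simp add: sgn)
  qed
  finally show ?thesis by (simp add: det_def)
qed

text \<open>The formula for absolutely integrable functions is applied to truncations of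
  \<open>f\<close>, which are bounded with bounded support. Monotone convergence removes the
  truncation, so both sides may be infinite.\<close>

lemma nn_integral_change_of_variables_wo:
  fixes g :: "real ^ 'm::{finite,wellorder} \<Rightarrow> real ^ 'm::_" and f :: "real ^ 'm::_ \<Rightarrow> real"
  assumes S: "S \<in> sets borel" and T: "g ` S \<in> sets borel"
    and der: "\<And>x. x \<in> S \<Longrightarrow> (g has_derivative g' x) (at x within S)"
    and inj: "inj_on g S"
    and f: "f \<in> borel_measurable borel" "\<And>y. f y \<ge> 0"
  shows "(\<integral>\<^sup>+y\<in>g ` S. ennreal (f y) \<partial>lborel) = (\<integral>\<^sup>+x\<in>S. ennreal (\<bar>det (matrix (g' x))\<bar> * f (g x)) \<partial>lborel)"
proof -
  define T where "T = g ` S"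
  define h where "h k y = (if norm y \<le> real k then min (f y) (real k) else 0)" for k y
  have Sl: "S \<in> sets lebesgue" using S by simp
  have contg: "continuous_on S g"
    using der by (meson continuous_on_eq_continuous_within has_derivative_continuous)
  have detm: "(\<lambda>x. det (matrix (g' x))) \<in> borel_measurable (lebesgue_on S)"
    by (rule borel_measurable_det_Jacobian[OF Sl der])
  have hm[measurable]: "h k \<in> borel_measurable borel" for k
    unfolding h_def using f(1) by measurable
  have gm: "g \<in> borel_measurable (lebesgue_on S)"
    by (rule continuous_imp_measurable_on_sets_lebesgue[OF contg Sl])
  have h0: "h k y \<ge> 0" for k y
    using f(2) by (auto simp: h_def)
  have one: "(\<integral>\<^sup>+y\<in>T. ennreal (h k y) \<partial>lborel) =
      (\<integral>\<^sup>+x\<in>S. ennreal (\<bar>det (matrix (g' x))\<bar> * h k (g x)) \<partial>lborel)" for k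
  proof -
    let ?J = "\<lambda>x. \<bar>det (matrix (g' x))\<bar> * h k (g x)"
    \<comment> \<open>The one-dimensional vector wrapper fits the formula for absolutely integrable
      functions, whose integrands are vector-valued.\<close>
    let ?v = "\<lambda>y. vec (h k y) :: real ^ 1"
    have hT: "h k absolutely_integrable_on T"
    proof -
      have "set_integrable lborel T (h k)"
        unfolding set_integrable_def
      proof (rule integrableI_bounded_set[where A = "cball 0 (real k)" and B = "real k"])
        show "(\<lambda>x. indicat_real T x *\<^sub>R h k x) \<in> borel_measurable lborel"
          using assms(2) unfolding T_def by measurable
        show "emeasure lborel (cball (0::real ^ 'm::_) (real k)) < \<infinity>"
          using emeasure_lborel_cball_finite by blast
        show "AE x in lborel. x \<in> cball 0 (real k) \<longrightarrow> norm (indicat_real T x *\<^sub>R h k x) \<le> real k"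
          using f(2) by (auto simp: h_def indicator_def)
        show "AE x in lborel. x \<notin> cball 0 (real k) \<longrightarrow> indicat_real T x *\<^sub>R h k x = 0"
          by (auto simp: h_def)
      qed simp
      then show ?thesis
        by (simp add: set_integrable_def integrable_completion assms(2) T_def borel_measurable_indicator)
    qed
    then have v: "?v absolutely_integrable_on T"
      by (simp add: absolutely_integrable_on_1_iff)
    have "(\<lambda>x. \<bar>det (matrix (g' x))\<bar> *\<^sub>R ?v (g x)) absolutely_integrable_on S \<and>
        integral S (\<lambda>x. \<bar>det (matrix (g' x))\<bar> *\<^sub>R ?v (g x)) = integral T ?v"
      using has_absolute_integral_change_of_variables[OF Sl der inj, of ?v "integral T ?v"] v
      by (simp add: T_def)
    moreover have "(\<lambda>x. \<bar>det (matrix (g' x))\<bar> *\<^sub>R ?v (g x)) = (\<lambda>x. vec (?J x))"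
      by (simp add: fun_eq_iff vec_eq_iff)
    ultimately have J: "?J absolutely_integrable_on S" "integral S ?J = integral T (h k)"
      using v by (simp_all add: absolutely_integrable_on_1_iff integral_on_1_eq)
    have "(\<integral>\<^sup>+x. ennreal (indicator S x * ?J x) \<partial>lborel) = ennreal (integral S ?J)"
      by (rule nn_integral_has_integral_lebesgue)
        (use J h0 in \<open>auto simp: absolutely_integrable_on_def has_integral_iff\<close>)
    moreover have "(\<integral>\<^sup>+y. ennreal (indicator T y * h k y) \<partial>lborel) = ennreal (integral T (h k))"
      by (rule nn_integral_has_integral_lebesgue)
        (use hT h0 in \<open>auto simp: absolutely_integrable_on_def has_integral_iff\<close>)
    ultimately show ?thesis
      using J(2) by (simp add: ennreal_mult' ennreal_indicator mult.commute)
  qed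
  have inc: "h k y \<le> h (Suc k) y" for k y
    using f(2) by (auto simp: h_def)
  have lim: "(SUP k. ennreal (c * h k y)) = ennreal (c * f y)" if "c \<ge> 0" for c y
  proof (rule LIMSEQ_unique[OF LIMSEQ_SUP])
    show "incseq (\<lambda>k. ennreal (c * h k y))"
      using inc that by (intro incseq_SucI ennreal_leI mult_left_mono)
    obtain k0 :: nat where k0: "max (norm y) (f y) \<le> real k0"
      using real_arch_simple by blast
    have "\<forall>\<^sub>F k in sequentially. ennreal (c * h k y) = ennreal (c * f y)"
      unfolding eventually_sequentially
      by (rule exI[of _ k0]) (use k0 in \<open>auto simp: h_def min_def\<close>)
    then show "(\<lambda>k. ennreal (c * h k y)) \<longlonglongrightarrow> ennreal (c * f y)"
      by (rule tendsto_eventually)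
  qed
  have lim_ind: "(SUP k. ennreal (c * h k y) * indicator A z) = ennreal (c * f y) * indicator A z"
    if "c \<ge> 0" for c y z and A :: "(real ^ 'm::_) set"
    by (subst SUP_mult_right_ennreal[symmetric]) (simp only: lim[OF that])
  have "(\<integral>\<^sup>+y\<in>T. ennreal (f y) \<partial>lborel) = (\<integral>\<^sup>+y. (SUP k. ennreal (h k y) * indicator T y) \<partial>lborel)"
    by (simp only: lim_ind[OF zero_le_one, unfolded mult_1])
  also have "\<dots> = (SUP k. \<integral>\<^sup>+y. ennreal (h k y) * indicator T y \<partial>lborel)"
    by (rule nn_integral_monotone_convergence_SUP)
      (use assms(2) inc in \<open>auto simp: T_def incseq_Suc_iff le_fun_def intro!: mult_right_mono ennreal_leI\<close>)
  \<comment> \<open>The Jacobian determinant is known to be measurable only in the Lebesgue sense,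
    so the limit is taken for the completed measure; completion does not change nonnegative
    integrals.\<close>
  also have "\<dots> = (SUP k. \<integral>\<^sup>+x\<in>S. ennreal (\<bar>det (matrix (g' x))\<bar> * h k (g x)) \<partial>lebesgue)"
    by (simp add: one nn_integral_completion)
  also have "\<dots> = (\<integral>\<^sup>+x. (SUP k. ennreal (\<bar>det (matrix (g' x))\<bar> * h k (g x)) * indicator S x) \<partial>lebesgue)"
  proof (rule nn_integral_monotone_convergence_SUP[symmetric])
    show "incseq (\<lambda>k x. ennreal (\<bar>det (matrix (g' x))\<bar> * h k (g x)) * indicator S x)"
      using inc by (auto simp: incseq_Suc_iff le_fun_def intro!: mult_right_mono mult_left_mono ennreal_leI)
    fix k
    have "(\<lambda>x. ennreal (\<bar>det (matrix (g' x))\<bar> * h k (g x))) \<in> borel_measurable (lebesgue_on S)"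
      using detm measurable_compose[OF gm hm[of k]] by measurable
    then show "(\<lambda>x. ennreal (\<bar>det (matrix (g' x))\<bar> * h k (g x)) * indicator S x) \<in> borel_measurable lebesgue"
      using Sl by (subst (asm) borel_measurable_restrict_space_iff_ennreal) auto
  qed
  also have "\<dots> = (\<integral>\<^sup>+x\<in>S. ennreal (\<bar>det (matrix (g' x))\<bar> * f (g x)) \<partial>lebesgue)"
    by (simp only: lim_ind[OF abs_ge_zero])
  finally show ?thesis
    by (simp add: T_def nn_integral_completion)
qed

text \<open>Lebesgue measure is characterized by its values on boxes, and the preimage of a box
  under a relabelling of coordinates is a box with the same side lengths.\<close>

lemma lborel_distr_Basis_bij:
  fixes r :: "'a::euclidean_space \<Rightarrow> 'b::euclidean_space"
  assumes r: "linear r" and b: "bij_betw \<beta> (Basis :: 'a set) (Basis :: 'b set)"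
    and comp: "\<And>x i. i \<in> Basis \<Longrightarrow> r x \<bullet> \<beta> i = x \<bullet> i"
  shows "distr lborel borel r = lborel"
proof (rule lborel_eqI[symmetric])
  have meas: "r \<in> borel_measurable borel"
    using r by (simp add: linear_continuous_on linear_conv_bounded_linear borel_measurable_continuous_onI)
  fix l u :: 'b assume lu: "\<And>b. b \<in> Basis \<Longrightarrow> l \<bullet> b \<le> u \<bullet> b"
  \<comment> \<open>\<open>s\<close> undoes the relabelling, so \<open>s l\<close> and
    \<open>s u\<close> are the corners of the preimage box.\<close>
  define s where "s z = (\<Sum>i\<in>Basis. (z \<bullet> \<beta> i) *\<^sub>R i)" for z
  have s: "s z \<bullet> i = z \<bullet> \<beta> i" if "i \<in> Basis" for z i
    using that by (simp add: s_def inner_sum_left inner_Basis if_distrib sum.delta cong: if_cong)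
  have bB: "\<beta> ` Basis = Basis" "\<And>i. i \<in> Basis \<Longrightarrow> \<beta> i \<in> Basis"
    using b by (auto simp: bij_betw_def)
  have "r -` box l u = box (s l) (s u)"
  proof -
    have "r x \<in> box l u \<longleftrightarrow> (\<forall>i\<in>\<beta> ` Basis. l \<bullet> i < r x \<bullet> i \<and> r x \<bullet> i < u \<bullet> i)" for x
      by (simp add: mem_box bB)
    then show ?thesis
      by (auto simp: mem_box s comp)
  qed
  then have "emeasure (distr lborel borel r) (box l u) = emeasure lborel (box (s l) (s u))"
    using meas by (simp add: emeasure_distr)
  also have "\<dots> = (\<Prod>i\<in>Basis. (s u - s l) \<bullet> i)"
    by (rule emeasure_lborel_box) (simp add: s bB lu)
  also have "(\<Prod>i\<in>Basis. (s u - s l) \<bullet> i) = (\<Prod>i\<in>Basis. (u - l) \<bullet> \<beta> i)"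
    by (simp add: inner_diff_left s)
  also have "\<dots> = (\<Prod>i\<in>Basis. (u - l) \<bullet> i)"
    by (rule prod.reindex_bij_betw[OF b])
  finally show "emeasure (distr lborel borel r) (box l u) = (\<Prod>i\<in>Basis. (u - l) \<bullet> i)" .
qed simp

lemma lborel_distr_reindex:
  fixes f :: "'m::finite \<Rightarrow> 'n::finite"
  assumes "bij f"
  shows "distr lborel borel (\<lambda>x :: real ^ 'n. \<chi> i. x $ f i) = lborel"
proof (rule lborel_distr_Basis_bij)
  show "linear (\<lambda>x :: real ^ 'n. \<chi> i. x $ f i)"
    by (auto intro!: linearI simp: vec_eq_iff)
  define \<beta> where "\<beta> b = (\<chi> i. b $ f i)" for b :: "real ^ 'n"
  have ax: "\<beta> (axis (f i) 1) = axis i 1" for i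
    using assms by (auto simp: \<beta>_def axis_def vec_eq_iff bij_def inj_eq)
  have Basis_f: "Basis = (\<lambda>i. axis (f i) (1::real)) ` UNIV"
  proof (intro equalityI subsetI)
    fix b :: "real ^ 'n" assume "b \<in> Basis"
    then obtain j where "b = axis j 1" by (auto simp: Basis_vec_def)
    moreover obtain i where "j = f i" using assms by (metis bij_pointE)
    ultimately show "b \<in> (\<lambda>i. axis (f i) 1) ` UNIV" by simp
  qed (auto simp: Basis_vec_def)
  have B: "Basis = (\<lambda>i::'m. axis i (1::real)) ` UNIV"
    by (auto simp: Basis_vec_def)
  show "bij_betw \<beta> Basis Basis"
    unfolding bij_betw_def Basis_f
  proof
    show "inj_on \<beta> (range (\<lambda>i. axis (f i) 1))"
      by (auto simp: inj_on_def ax axis_eq_axis)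
    show "\<beta> ` range (\<lambda>i. axis (f i) 1) = Basis"
      unfolding B by (simp add: image_image ax)
  qed
  show "(\<chi> i. x $ f i) \<bullet> \<beta> b = x \<bullet> b" if b: "b \<in> Basis" for x b :: "real ^ 'n"
  proof -
    obtain i where "b = axis (f i) 1"
      using b Basis_f by auto
    then show ?thesis
      by (simp add: ax inner_axis)
  qed
qed

text \<open>Conjugation with the relabellings \<open>r\<close> and \<open>q\<close> preserves
  Lebesgue measure and the Jacobian determinant. Hypothesis \<open>m\<close> is there because
  transporting the right-hand integral along \<open>q\<close> needs a Borel measurable integrand,
  while the Jacobian determinant is a priori only Lebesgue measurable.\<close>

theorem nn_integral_change_of_variables:
  fixes g :: "real ^ 'n::finite \<Rightarrow> real ^ 'n" and f :: "real ^ 'n \<Rightarrow> real"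
  assumes S: "S \<in> sets borel" and T: "g ` S \<in> sets borel"
    and der: "\<And>x. x \<in> S \<Longrightarrow> (g has_derivative g' x) (at x within S)"
    and inj: "inj_on g S"
    and f: "f \<in> borel_measurable borel" "\<And>y. f y \<ge> 0"
    and m: "(\<lambda>x. ennreal (\<bar>det (matrix (g' x))\<bar> * f (g x)) * indicator S x) \<in> borel_measurable borel"
  shows "(\<integral>\<^sup>+y\<in>g ` S. ennreal (f y) \<partial>lborel) = (\<integral>\<^sup>+x\<in>S. ennreal (\<bar>det (matrix (g' x))\<bar> * f (g x)) \<partial>lborel)"
proof -
  define r :: "real ^ 'n \<Rightarrow> real ^ 'n wo" where "r x = (\<chi> i. x $ Rep_wo i)" for x
  define q :: "real ^ 'n wo \<Rightarrow> real ^ 'n" where "q y = (\<chi> i. y $ Abs_wo i)" for y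
  have bij: "bij (Rep_wo :: 'n wo \<Rightarrow> 'n)" "bij (Abs_wo :: 'n \<Rightarrow> 'n wo)"
    by (auto intro!: bij_betw_byWitness[of _ Abs_wo] bij_betw_byWitness[of _ Rep_wo]
        simp: Rep_wo_inverse Abs_wo_inverse)
  have rq: "r (q y) = y" "q (r x) = x" for x y
    by (simp_all add: r_def q_def vec_eq_iff Rep_wo_inverse Abs_wo_inverse)
  have lin: "bounded_linear r" "bounded_linear q"
    by (auto intro!: linearI simp: linear_conv_bounded_linear[symmetric] r_def q_def vec_eq_iff)
  have [measurable]: "r \<in> borel_measurable borel" "q \<in> borel_measurable borel"
    using lin by (auto intro!: borel_measurable_continuous_onI linear_continuous_on)
  have dist: "distr lborel borel q = lborel"
    using lborel_distr_reindex[OF bij(2)] by (simp add: q_def[abs_def])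
  have trans: "(\<integral>\<^sup>+x. h x \<partial>lborel) = (\<integral>\<^sup>+y. h (q y) \<partial>lborel)" if "h \<in> borel_measurable borel" for h
    using nn_integral_distr[of q lborel borel h] that by (simp add: dist)
  have img: "r ` A = q -` A" for A
    using rq by (auto simp: image_iff) (metis)
  have mem: "q y \<in> A \<longleftrightarrow> y \<in> r ` A" for y A
    by (simp add: img)
  define G where "G y = r (g (q y))" for y
  define G' where "G' y = r \<circ> g' (q y) \<circ> q" for y
  have rS: "r ` S \<in> sets borel" "r ` (g ` S) \<in> sets borel"
    using S T measurable_sets[of q borel borel] unfolding img by auto
  have G: "G ` (r ` S) = r ` (g ` S)"
    by (auto simp: G_def rq image_image)
  have det: "det (matrix (G' y)) = det (matrix (g' (q y)))" for y
  proof -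
    have "q (axis j 1) = axis (Rep_wo j) (1::real)" for j
      by (auto simp: q_def vec_eq_iff axis_def Rep_wo_inverse Abs_wo_inverse)
    then have "matrix (G' y) = (\<chi> i j. matrix (g' (q y)) $ Rep_wo i $ Rep_wo j)"
      by (auto simp: matrix_def G'_def r_def intro!: vec_eq_iff[THEN iffD2])
    then show ?thesis
      by (simp add: det_reindex[OF bij(1)])
  qed
  have "(\<integral>\<^sup>+y\<in>G ` (r ` S). ennreal (f (q y)) \<partial>lborel) =
      (\<integral>\<^sup>+x\<in>r ` S. ennreal (\<bar>det (matrix (G' x))\<bar> * f (q (G x))) \<partial>lborel)"
  proof (rule nn_integral_change_of_variables_wo)
    show "inj_on G (r ` S)"
      using inj by (auto simp: inj_on_def G_def rq) (metis rq(2))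
    show "(G has_derivative G' x) (at x within r ` S)" if "x \<in> r ` S" for x
    proof -
      have q: "(q has_derivative q) (at x within r ` S)"
        using lin(2) by (rule bounded_linear_imp_has_derivative)
      have "q x \<in> S" "q ` r ` S = S" using that by (auto simp: rq image_image)
      then have "((g \<circ> q) has_derivative g' (q x) \<circ> q) (at x within r ` S)"
        using diff_chain_within[OF q] der by metis
      from bounded_linear.has_derivative[OF lin(1) this] show ?thesis
        by (simp add: G_def[abs_def] G'_def o_def)
    qed
  qed (use rS f in \<open>auto simp: G\<close>)
  then have eq: "(\<integral>\<^sup>+y. ennreal (f (q y)) * indicator (r ` g ` S) y \<partial>lborel) =
      (\<integral>\<^sup>+x. ennreal (\<bar>det (matrix (g' (q x)))\<bar> * f (g (q x))) * indicator (r ` S) x \<partial>lborel)"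
    by (simp only: G det G_def rq)
  have ind: "indicator (r ` A) y = (indicator A (q y) :: ennreal)" for A y
    by (simp add: indicator_def mem)
  have "(\<lambda>y. ennreal (f y) * indicator (g ` S) y) \<in> borel_measurable borel"
    using T f(1) by measurable
  from trans[OF this] trans[OF m] eq show ?thesis
    by (simp only: ind)
qed

section \<open>Smooth functions and cutoffs\<close>

lemma Ck_on_derivative:
  assumes "Ck_on (Suc k) U f" "open U" "x \<in> U"
  shows "(f has_derivative frechet_derivative f (at x)) (at x)"
proof -
  have "f differentiable (at x within U)"
    using assms by (simp add: differentiable_on_def)
  then show ?thesis
    using at_within_open[OF assms(3,2)] frechet_derivative_works by metis
qed

lemma Ck_on_cong:
  assumes "Ck_on k U f" "open U" "\<And>x. x \<in> U \<Longrightarrow> f x = g x"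
  shows "Ck_on k U g"
  using assms
proof (induction k arbitrary: f g)
  case 0
  then show ?case using continuous_on_cong[OF refl, of U f g] by simp
next
  case (Suc k)
  have g: "(g has_derivative frechet_derivative f (at x)) (at x)" if "x \<in> U" for x
    by (rule has_derivative_transform_within_open[OF Ck_on_derivative[OF Suc.prems(1,2) that] Suc.prems(2) that])
      (rule Suc.prems(3))
  then have "g differentiable_on U"
    by (auto simp: differentiable_on_def differentiable_def intro: has_derivative_at_withinI)
  moreover have "Ck_on k U (\<lambda>x. frechet_derivative g (at x) v)" for v
  proof (rule Suc.IH[of "\<lambda>x. frechet_derivative f (at x) v"])
    show "Ck_on k U (\<lambda>x. frechet_derivative f (at x) v)" using Suc.prems(1) by simp
    show "frechet_derivative f (at x) v = frechet_derivative g (at x) v" if "x \<in> U" for x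
      using frechet_derivative_at[OF g[OF that]] by (rule fun_cong)
  qed (rule Suc.prems(2))
  ultimately show ?case by simp
qed

text \<open>\<open>Ck_on\<close> refers to \<open>frechet_derivative\<close>, a value given by
  choice. This rule accepts any explicit derivative instead and is the form in which the sum,
  product and chain rules enter the inductions.\<close>

lemma Ck_on_SucI:
  assumes "open U" "\<And>x. x \<in> U \<Longrightarrow> (f has_derivative f' x) (at x)"
    and "\<And>v. Ck_on k U (\<lambda>x. f' x v)"
  shows "Ck_on (Suc k) U f"
proof -
  have "frechet_derivative f (at x) = f' x" if "x \<in> U" for x
    using frechet_derivative_at[OF assms(2)[OF that]] by (rule sym)
  then have "Ck_on k U (\<lambda>x. frechet_derivative f (at x) v)" for v
    using assms(1) by (intro Ck_on_cong[OF assms(3)[of v]]) auto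
  then show ?thesis
    using assms(1,2) by (auto simp: differentiable_on_def differentiable_def intro: has_derivative_at_withinI)
qed

lemma Ck_on_SucD: "Ck_on (Suc k) U f \<Longrightarrow> Ck_on k U f"
proof (induction k arbitrary: f)
  case 0
  then show ?case by (simp add: differentiable_imp_continuous_on)
next
  case (Suc k)
  then show ?case by (metis Ck_on.simps(2))
qed

lemma Ck_on_subset: "Ck_on k U f \<Longrightarrow> V \<subseteq> U \<Longrightarrow> Ck_on k V f"
proof (induction k arbitrary: f)
  case 0
  then show ?case using continuous_on_subset by auto
next
  case (Suc k)
  then show ?case using differentiable_on_subset by auto
qed

lemma Ck_on_const: "open U \<Longrightarrow> Ck_on k U (\<lambda>x. c)"
  by (induction k arbitrary: c) auto

lemma Ck_on_add:
  "Ck_on k U f \<Longrightarrow> Ck_on k U g \<Longrightarrow> open U \<Longrightarrow> Ck_on k U (\<lambda>x. f x + g x)"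
proof (induction k arbitrary: f g)
  case 0
  then show ?case by (simp add: continuous_on_add)
next
  case (Suc k)
  show ?case
    by (rule Ck_on_SucI[OF \<open>open U\<close> has_derivative_add[OF Ck_on_derivative[where k = k] Ck_on_derivative[where k = k]]])
      (use Suc in auto)
qed

lemma Ck_on_sum:
  "finite I \<Longrightarrow> (\<And>i. i \<in> I \<Longrightarrow> Ck_on k U (f i)) \<Longrightarrow> open U \<Longrightarrow> Ck_on k U (\<lambda>x. \<Sum>i\<in>I. f i x)"
  by (induction I rule: finite_induct) (simp_all add: Ck_on_const Ck_on_add)

lemma Ck_on_bounded_linear_comp:
  assumes "bounded_linear L"
  shows "Ck_on k U f \<Longrightarrow> open U \<Longrightarrow> Ck_on k U (\<lambda>x. L (f x))"
proof (induction k arbitrary: f)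
  case 0
  then show ?case using assms by (simp add: bounded_linear.continuous_on)
next
  case (Suc k)
  show ?case
    by (rule Ck_on_SucI[OF \<open>open U\<close> bounded_linear.has_derivative[OF assms Ck_on_derivative[where k = k]]])
      (use Suc in auto)
qed

lemma Ck_on_bounded_linear:
  assumes "bounded_linear L" "open U"
  shows "Ck_on k U L"
proof (cases k)
  case 0
  then show ?thesis using assms by (simp add: linear_continuous_on)
next
  case (Suc m)
  then show ?thesis
    by (metis Ck_on_SucI[OF assms(2), of L "\<lambda>_. L" m] bounded_linear_imp_has_derivative[OF assms(1)]
      Ck_on_const[OF assms(2)])
qed

lemma Ck_on_scaleR:
  "Ck_on k U f \<Longrightarrow> Ck_on k U g \<Longrightarrow> open U \<Longrightarrow> Ck_on k U (\<lambda>x. f x *\<^sub>R g x)"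
proof (induction k arbitrary: f g)
  case 0
  then show ?case by (simp add: continuous_on_scaleR)
next
  case (Suc k)
  show ?case
    by (rule Ck_on_SucI[OF \<open>open U\<close> has_derivative_scaleR[OF Ck_on_derivative[where k = k] Ck_on_derivative[where k = k]]])
      (use Suc.prems Ck_on_SucD[OF Suc.prems(1)] Ck_on_SucD[OF Suc.prems(2)] in
        \<open>simp_all add: Ck_on_add Suc.IH\<close>)
qed

lemma linear_Basis_expansion:
  fixes L :: "'a::euclidean_space \<Rightarrow> 'b::real_vector"
  assumes "linear L"
  shows "L w = (\<Sum>b\<in>Basis. (w \<bullet> b) *\<^sub>R L b)"
proof -
  interpret linear L by fact
  have "L (\<Sum>b\<in>Basis. (w \<bullet> b) *\<^sub>R b) = (\<Sum>b\<in>Basis. (w \<bullet> b) *\<^sub>R L b)"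
    by (simp only: sum scale)
  then show ?thesis
    by (simp only: euclidean_representation)
qed

lemma Ck_on_compose:
  fixes g :: "'a::real_normed_vector \<Rightarrow> 'b::euclidean_space" and f :: "'b \<Rightarrow> 'c::real_normed_vector"
  shows "Ck_on k V f \<Longrightarrow> Ck_on k U g \<Longrightarrow> open U \<Longrightarrow> open V \<Longrightarrow> g ` U \<subseteq> V \<Longrightarrow> Ck_on k U (\<lambda>x. f (g x))"
proof (induction k arbitrary: f)
  case 0
  then show ?case using continuous_on_compose2[of V f U g] by simp
next
  case (Suc k)
  \<comment> \<open>\<open>Ck_on\<close> speaks of derivatives in fixed directions only. In the
    chain rule the direction moves with \<open>x\<close>, so it is expanded in the standard basis,
    and the derivative becomes a sum of products to which the induction applies.\<close>
  let ?D = "\<lambda>x v. \<Sum>b\<in>Basis. (frechet_derivative g (at x) v \<bullet> b) *\<^sub>R frechet_derivative f (at (g x)) b"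
  show ?case
  proof (rule Ck_on_SucI[where f' = ?D])
    fix x assume x: "x \<in> U"
    then have gx: "g x \<in> V" using Suc.prems by auto
    have f': "(f has_derivative frechet_derivative f (at (g x))) (at (g x))"
      by (rule Ck_on_derivative[OF Suc.prems(1,4) gx])
    have "((\<lambda>x. f (g x)) has_derivative (\<lambda>v. frechet_derivative f (at (g x)) (frechet_derivative g (at x) v))) (at x)"
      by (rule has_derivative_compose[OF Ck_on_derivative[OF Suc.prems(2,3) x] f'])
    then show "((\<lambda>x. f (g x)) has_derivative ?D x) (at x)"
      unfolding linear_Basis_expansion[OF has_derivative_linear[OF f'], symmetric] .
  next
    fix v
    have 1: "Ck_on k U (\<lambda>x. frechet_derivative g (at x) v)"
      using Suc.prems(2) by simp
    have 2: "Ck_on k U (\<lambda>x. frechet_derivative f (at (g x)) b)" for b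
      by (rule Suc.IH[of "\<lambda>z. frechet_derivative f (at z) b"])
        (use Suc.prems Ck_on_SucD[OF Suc.prems(2)] in simp_all)
    show "Ck_on k U (\<lambda>x. ?D x v)"
      using Suc.prems(3) by (intro Ck_on_sum Ck_on_scaleR 2
          Ck_on_bounded_linear_comp[OF bounded_linear_inner_left 1]) simp_all
  qed (rule Suc.prems(3))
qed

lemma smooth_on_compose:
  fixes g :: "'a::real_normed_vector \<Rightarrow> 'b::euclidean_space"
  assumes g: "smooth_on A g" and f: "\<And>k. Ck_on k UNIV f"
  shows "smooth_on A (\<lambda>x. f (g x))"
  unfolding smooth_on_def
proof
  fix a assume "a \<in> A"
  then obtain U h where U: "open U" "a \<in> U" "\<forall>k. Ck_on k U h" "\<forall>x\<in>A \<inter> U. h x = g x"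
    using g unfolding smooth_on_def by blast
  have "Ck_on k U (\<lambda>x. f (h x))" for k
    by (rule Ck_on_compose[OF f]) (use U in auto)
  then show "\<exists>U h. open U \<and> a \<in> U \<and> (\<forall>k. Ck_on k U h) \<and> (\<forall>x\<in>A \<inter> U. h x = f (g x))"
    using U by (intro exI[of _ U] exI[of _ "\<lambda>x. f (h x)"] conjI ballI allI) auto
qed

section \<open>The flat function exp(-1/t), steps and cutoffs\<close>

definition flat_exp :: "nat \<Rightarrow> real \<Rightarrow> real" where
  "flat_exp n t = (if t > 0 then inverse t ^ n * exp (- inverse t) else 0)"

lemma flat_exp_nonneg: "flat_exp n t \<ge> 0"
  by (simp add: flat_exp_def)

text \<open>With u = 1/t, one term of the exponential series gives u^(n+2)/(n+2)! \<le> exp u. The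
  exponent n + 2 leaves a quadratic bound, so that the difference quotient at 0 tends to 0.\<close>

lemma flat_exp_le: "flat_exp n t \<le> fact (n + 2) * t\<^sup>2"
proof (cases "t > 0")
  case True
  define u where "u = inverse t"
  have u: "u > 0" "t = inverse u" using True by (auto simp: u_def)
  have "u ^ (n + 2) / fact (n + 2) \<le> exp u"
    using sum_le_suminf[OF summable_exp_generic[of u], of "{n + 2}"] u(1)
    by (simp add: exp_def divide_inverse mult.commute)
  moreover have "u ^ n * exp (- u) \<le> K * (inverse u)\<^sup>2" if "u ^ (n + 2) / K \<le> exp u" "K > 0" for K
    using u that by (simp add: exp_minus field_simps power2_eq_square)
  ultimately have "u ^ n * exp (- u) \<le> fact (n + 2) * (inverse u)\<^sup>2"
    by simp
  then show ?thesis
    using True by (simp add: flat_exp_def u_def)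
qed (simp add: flat_exp_def)

text \<open>The derivative of a member of the family combines two other members. This is why powers
  of 1/t are carried along: smoothness follows by induction on the order, for all \<open>n\<close>
  simultaneously.\<close>

lemma flat_exp_deriv:
  "(flat_exp n has_real_derivative flat_exp (n + 2) t - n * flat_exp (n + 1) t) (at t)"
proof -
  consider "t > 0" | "t < 0" | "t = 0" by linarith
  then show ?thesis
  proof cases
    case 1
    have "((\<lambda>t. inverse t ^ n * exp (- inverse t)) has_real_derivative
        flat_exp (n + 2) t - n * flat_exp (n + 1) t) (at t)"
      using 1 by (auto intro!: derivative_eq_intros simp: flat_exp_def)
        (cases n; simp add: field_simps power2_eq_square)
    then show ?thesis
      by (rule has_field_derivative_transform_within_open[of _ _ _ "{0<..}"])
        (use 1 in \<open>auto simp: flat_exp_def\<close>)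
  next
    case 2
    have "((\<lambda>t. 0) has_real_derivative 0) (at t)" by simp
    then show ?thesis
      using 2 has_field_derivative_transform_within_open[of "\<lambda>t. 0" 0 t "{..<0}" "flat_exp n"]
      by (auto simp: flat_exp_def)
  next
    case 3
    have "((\<lambda>h. flat_exp n h / h) \<longlongrightarrow> 0) (at 0)"
    proof (rule Lim_null_comparison)
      have "norm (flat_exp n h / h) \<le> fact (n + 2) * \<bar>h\<bar>" if "h \<noteq> 0" for h
      proof -
        have "norm (flat_exp n h / h) = flat_exp n h / \<bar>h\<bar>"
          using flat_exp_nonneg[of n h] by simp
        also have "\<dots> \<le> fact (n + 2) * h\<^sup>2 / \<bar>h\<bar>"
          using flat_exp_le[of n h] by (rule divide_right_mono) simp
        also have "\<dots> = fact (n + 2) * (h\<^sup>2 / \<bar>h\<bar>)"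
          by (simp only: times_divide_eq_right)
        also have "h\<^sup>2 / \<bar>h\<bar> = \<bar>h\<bar>"
          using that by (simp add: power2_eq_square abs_if)
        finally show ?thesis .
      qed
      then show "\<forall>\<^sub>F h in at 0. norm (flat_exp n h / h) \<le> fact (n + 2) * \<bar>h\<bar>"
        by (auto simp: eventually_at_filter)
      show "((\<lambda>h. fact (n + 2) * \<bar>h\<bar>) \<longlongrightarrow> (0::real)) (at 0)"
        by (auto intro!: tendsto_eq_intros)
    qed
    then show ?thesis
      using 3 by (simp add: DERIV_def flat_exp_def cong: if_cong)
  qed
qed

lemma Ck_on_real_derivative:
  fixes f :: "real \<Rightarrow> real"
  assumes "open U" "\<And>t. t \<in> U \<Longrightarrow> (f has_real_derivative f' t) (at t)" "Ck_on k U f'"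
  shows "Ck_on (Suc k) U f"
  by (rule Ck_on_SucI[OF assms(1), where f' = "\<lambda>t h. f' t * h"])
    (use assms in \<open>auto simp: has_field_derivative_def intro: Ck_on_bounded_linear_comp[OF bounded_linear_mult_left]\<close>)

lemma Ck_on_flat_exp: "Ck_on k UNIV (flat_exp n)"
proof (induction k arbitrary: n)
  case 0
  show ?case
    using flat_exp_deriv by (auto intro!: continuous_at_imp_continuous_on DERIV_isCont)
next
  case (Suc k)
  have "Ck_on k UNIV (\<lambda>t. flat_exp (n + 2) t + (- real n) *\<^sub>R flat_exp (n + 1) t)"
    by (intro Ck_on_add Ck_on_scaleR Ck_on_const Suc) auto
  then show ?case
    by (intro Ck_on_real_derivative[OF _ flat_exp_deriv]) auto
qed

text \<open>Powers are stable under differentiation up to a constant factor, so one induction covers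
  all exponents; the exponent 1/2 provides the square root away from 0.\<close>

lemma Ck_on_powr: "Ck_on k {0<..} (\<lambda>t::real. t powr r)"
proof (induction k arbitrary: r)
  case 0
  show ?case by (auto intro!: continuous_intros)
next
  case (Suc k)
  have "Ck_on k {0<..} (\<lambda>t::real. r *\<^sub>R t powr (r - 1))"
    by (intro Ck_on_scaleR Ck_on_const Suc) auto
  then show ?case
    by (intro Ck_on_real_derivative[where f' = "\<lambda>t. r * t powr (r - 1)"])
      (auto intro!: derivative_eq_intros)
qed

text \<open>A step over the unit interval must have slope at least 1 somewhere, and 1/q comes
  arbitrarily close. The step is the normalized primitive of a bump with values in [0,1] that is
  nearly 1 except close to both ends.\<close>

lemma smooth_step:
  assumes q: "0 < q" "q < 1"
  obtains \<psi> :: "real \<Rightarrow> real" where "\<And>k. Ck_on k UNIV \<psi>" "\<And>t. t \<le> 0 \<Longrightarrow> \<psi> t = 0" "\<And>t. t \<ge> 1 \<Longrightarrow> \<psi> t = 1"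
    "\<And>t. 0 \<le> \<psi> t" "\<And>t. \<psi> t \<le> 1" "\<And>s t. \<bar>\<psi> s - \<psi> t\<bar> \<le> \<bar>s - t\<bar> / q"
proof -
  \<comment> \<open>From 4 \<delta> = 1 - q one gets (1 - \<delta>)(1 - 2 \<delta>) \<ge> 1 - 3
    \<delta> \<ge> q, the mass of the bump. The factor \<open>c\<close> makes 1/(c s) \<le>
    \<delta>/2 for s \<ge> \<delta>, so each of the two exponents costs at most \<delta>/2.\<close>
  define \<delta> where "\<delta> = (1 - q) / 4"
  define c where "c = 2 / \<delta>\<^sup>2"
  have \<delta>: "0 < \<delta>" "\<delta> < 1 / 4" "c > 0"
    using q by (auto simp: \<delta>_def c_def)
  define \<rho> where "\<rho> t = flat_exp 0 (c * t) * flat_exp 0 (c * (1 - t))" for t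
  have aff: "Ck_on k UNIV (\<lambda>t. c * t)" "Ck_on k UNIV (\<lambda>t. c * (1 - t))" for k
  proof -
    show "Ck_on k UNIV (\<lambda>t. c * t)"
      by (intro Ck_on_bounded_linear bounded_linear_mult_right) auto
    have "Ck_on k UNIV (\<lambda>t. c + (- c) * t)"
      by (intro Ck_on_add Ck_on_const Ck_on_bounded_linear bounded_linear_mult_right) auto
    then show "Ck_on k UNIV (\<lambda>t. c * (1 - t))"
      by (simp add: algebra_simps)
  qed
  have \<rho>_Ck: "Ck_on k UNIV \<rho>" for k
    unfolding \<rho>_def[abs_def] real_scaleR_def[symmetric]
    using Ck_on_compose[OF Ck_on_flat_exp aff(1)] Ck_on_compose[OF Ck_on_flat_exp aff(2)]
    by (intro Ck_on_scaleR) auto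
  have fe: "flat_exp 0 t \<le> 1" for t
    by (simp add: flat_exp_def)
  have \<rho>: "0 \<le> \<rho> t" "\<rho> t \<le> 1" "t \<le> 0 \<or> t \<ge> 1 \<Longrightarrow> \<rho> t = 0" for t
  proof -
    show "0 \<le> \<rho> t" "\<rho> t \<le> 1"
      using fe flat_exp_nonneg by (auto simp: \<rho>_def intro: mult_le_one)
    show "t \<le> 0 \<or> t \<ge> 1 \<Longrightarrow> \<rho> t = 0"
      using \<delta>(3) by (auto simp: \<rho>_def flat_exp_def zero_less_mult_iff)
  qed
  have \<rho>_low: "\<rho> t \<ge> 1 - \<delta>" if "\<delta> \<le> t" "t \<le> 1 - \<delta>" for t
  proof -
    have *: "inverse (c * s) \<le> \<delta> / 2" if "\<delta> \<le> s" for s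
      using \<delta> that by (simp add: c_def field_simps power2_eq_square)
    have "1 - \<delta> \<le> 1 - (inverse (c * t) + inverse (c * (1 - t)))"
      using *[of t] *[of "1 - t"] that by simp
    also have "\<dots> \<le> exp (- (inverse (c * t) + inverse (c * (1 - t))))"
      by (metis exp_ge_add_one_self diff_conv_add_uminus)
    also have "\<dots> = \<rho> t"
      using \<delta> that by (simp add: \<rho>_def flat_exp_def exp_add[symmetric])
    finally show ?thesis .
  qed
  have cont: "continuous_on A \<rho>" for A
    using \<rho>_Ck[of 0] continuous_on_subset by auto
  then have int: "\<rho> integrable_on {a..b}" for a b
    by (rule integrable_continuous_real)
  \<comment> \<open>The bump vanishes on the negative axis, so starting at -1 adds nothing to the
    integral and makes 0 an interior point of the interval when \<open>P\<close> is differentiated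
    there.\<close>
  define P where "P t = integral {-1..t} \<rho>" for t
  have Pneg: "P t = 0" if "t \<le> 0" for t
  proof -
    have "P t = integral {-1..t} (\<lambda>_. 0)"
      unfolding P_def by (rule integral_cong) (use \<rho>(3) that in auto)
    then show ?thesis by simp
  qed
  have Pder: "(P has_real_derivative \<rho> t) (at t)" for t
  proof (cases "t < 0")
    case True
    have "((\<lambda>t. 0) has_real_derivative 0) (at t)" by simp
    then show ?thesis
      using True \<rho>(3)[of t] has_field_derivative_transform_within_open[of "\<lambda>t. 0" 0 t "{..<0}" P]
      by (auto simp: Pneg)
  next
    case False
    have "(P has_real_derivative \<rho> t) (at t within {-1..t + 1})"
      unfolding P_def[abs_def] by (rule integral_has_real_derivative[OF cont]) (use False in auto)
    moreover have "t \<in> interior {-1..t + 1}" using False by auto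
    ultimately show ?thesis by (metis at_within_interior)
  qed
  have Pmono: "P s \<le> P t" if "s \<le> t" for s t
    using that Pder \<rho>(1) by (metis DERIV_nonneg_imp_nondecreasing)
  have Pone: "P t = P 1" if "t \<ge> 1" for t
  proof -
    have "P t = P 1 + integral {1..t} \<rho>"
      unfolding P_def using that int by (intro Henstock_Kurzweil_Integration.integral_combine[symmetric]) auto
    moreover have "integral {1..t} \<rho> = integral {1..t} (\<lambda>_. 0)"
      by (rule integral_cong) (use \<rho>(3) in auto)
    ultimately show ?thesis by simp
  qed
  have "q \<le> (1 - \<delta>) * (1 - 2 * \<delta>)"
  proof -
    have "(1 - \<delta>) * (1 - 2 * \<delta>) = 1 - 3 * \<delta> + 2 * \<delta>\<^sup>2"
      by (simp add: algebra_simps power2_eq_square)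
    moreover have "4 * \<delta> = 1 - q" by (simp add: \<delta>_def)
    then have "q \<le> 1 - 3 * \<delta>" using \<delta>(1) by linarith
    ultimately show ?thesis using zero_le_power2[of \<delta>] by linarith
  qed
  also have "\<dots> = integral {\<delta>..1 - \<delta>} (\<lambda>_. 1 - \<delta>)"
    using \<delta> by simp
  also have "\<dots> \<le> integral {\<delta>..1 - \<delta>} \<rho>"
    by (rule integral_le) (use int \<rho>_low in auto)
  also have "\<dots> \<le> P 1"
    unfolding P_def by (rule integral_subset_le) (use int \<rho> \<delta> in auto)
  finally have J: "q \<le> P 1" .
  define \<psi> where "\<psi> t = P t / P 1" for t
  show ?thesis
  proof (rule that[of \<psi>])
    show "Ck_on k UNIV \<psi>" for k
    proof -
      have "Ck_on (Suc k) UNIV P"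
        using Pder \<rho>_Ck by (intro Ck_on_real_derivative) auto
      then have "Ck_on k UNIV P" by (rule Ck_on_SucD)
      then show ?thesis
        unfolding \<psi>_def[abs_def] by (rule Ck_on_bounded_linear_comp[OF bounded_linear_divide]) simp
    qed
    show "\<psi> t = 0" if "t \<le> 0" for t using Pneg[OF that] by (simp add: \<psi>_def)
    show one: "\<psi> t = 1" if "t \<ge> 1" for t using Pone[OF that] J q by (simp add: \<psi>_def)
    have mono: "\<psi> s \<le> \<psi> t" if "s \<le> t" for s t
      using Pmono[OF that] J q by (simp add: \<psi>_def divide_right_mono)
    show "0 \<le> \<psi> t" for t
      using mono[of "min t 0" t] Pneg[of "min t 0"] by (simp add: \<psi>_def)
    show "\<psi> t \<le> 1" for t
      using mono[of t "max t 1"] one[of "max t 1"] by simp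
    \<comment> \<open>The bump is at most 1, so \<open>P\<close> is 1-Lipschitz; division by the
      total rise \<open>P 1\<close>, which is at least \<open>q\<close>, gives the slope
      1/q.\<close>
    have "norm (P s - P t) \<le> 1 * norm (s - t)" for s t
      using Pder \<rho>
      by (intro field_differentiable_bound[where S = UNIV and f' = \<rho>]) auto
    then have "\<bar>P s - P t\<bar> / P 1 \<le> \<bar>s - t\<bar> / q" for s t
      using J q by (intro frac_le) auto
    then show "\<bar>\<psi> s - \<psi> t\<bar> \<le> \<bar>s - t\<bar> / q" for s t
      using J q by (simp add: \<psi>_def flip: diff_divide_distrib)
  qed
qed

lemma Ck_on_norm_squared: "Ck_on k UNIV (\<lambda>x :: 'a::euclidean_space. (norm (x - a))\<^sup>2)"
proof -
  have inner: "Ck_on k UNIV (\<lambda>x. (x - a) \<bullet> b)" for b :: 'a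
  proof -
    have "Ck_on k UNIV (\<lambda>x. x \<bullet> b + - (a \<bullet> b))"
      by (intro Ck_on_add Ck_on_const Ck_on_bounded_linear bounded_linear_inner_left) auto
    then show ?thesis by (simp add: inner_diff_left)
  qed
  have "Ck_on k UNIV (\<lambda>x. \<Sum>b\<in>Basis. ((x - a) \<bullet> b) *\<^sub>R ((x - a) \<bullet> b))"
    by (intro Ck_on_sum Ck_on_scaleR inner) auto
  moreover have "(norm (x - a))\<^sup>2 = (\<Sum>b\<in>Basis. ((x - a) \<bullet> b) *\<^sub>R ((x - a) \<bullet> b))" for x
    unfolding power2_norm_eq_inner euclidean_inner[of "x - a" "x - a"] by simp
  ultimately show ?thesis by simp
qed

text \<open>The norm is not smooth at the origin and is replaced by w(x) = sqrt(|x|^2 + \<eta>^2),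
  the norm of the pair (x, \<eta>), which is smooth and still 1-Lipschitz. The step is applied to
  the affine function of w that is 1 for |x| = R and 0 for |x| = b.\<close>

lemma smooth_cutoff:
  assumes R: "R > 0" and c: "c > 1 / R"
  obtains F :: "'a::euclidean_space \<Rightarrow> real" and b where "b < 2 * R"
    "\<And>k. Ck_on k UNIV F" "\<And>x. norm x \<le> R \<Longrightarrow> F x = 1" "\<And>x. norm x \<ge> b \<Longrightarrow> F x = 0"
    "\<And>x. 0 \<le> F x" "\<And>x. F x \<le> 1" "\<And>x y. \<bar>F x - F y\<bar> \<le> c * norm (x - y)"
proof -
  \<comment> \<open>\<tau> < 1 measures the room left by c > 1/R. It is shared between the slope 1/q
    of the step and a loss 2 \<eta> in the width of the transition; \<eta> solves q (R - 2 \<eta>) =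
    1/c.\<close>
  define \<tau> where "\<tau> = 1 / (c * R)"
  have cpos: "c > 0" using R c by (meson less_trans zero_less_divide_1_iff)
  have \<tau>: "0 < \<tau>" "\<tau> < 1" "1 / c = \<tau> * R"
    using R c cpos by (auto simp: \<tau>_def field_simps)
  define q where "q = (1 + \<tau>) / 2"
  have q: "0 < q" "q < 1" "\<tau> < q" using \<tau> by (auto simp: q_def)
  define \<eta> where "\<eta> = R * (1 - \<tau> / q) / 2"
  have \<eta>: "\<eta> > 0" "q * (R - 2 * \<eta>) = \<tau> * R" using q R by (auto simp: \<eta>_def field_simps)
  define w where "w x = sqrt ((norm x)\<^sup>2 + \<eta>\<^sup>2)" for x :: 'a
  have w_norm: "w x = norm (x, \<eta>)" for x by (simp add: w_def norm_Pair)
  define b where "b = 2 * R - \<eta>"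
  define a' where "a' = sqrt (R\<^sup>2 + \<eta>\<^sup>2)"
  define b' where "b' = sqrt (b\<^sup>2 + \<eta>\<^sup>2)"
  have b0: "b \<ge> 0" using \<eta> R q \<tau> by (simp add: b_def \<eta>_def field_simps)
  \<comment> \<open>Since b' \<ge> b = 2R - \<eta> and a' \<le> R + \<eta>, the transition measured
    in w keeps a width of at least R - 2 \<eta>.\<close>
  have "b' \<ge> b" unfolding b'_def using b0 by (intro real_le_rsqrt) auto
  moreover have "a' \<le> R + \<eta>" unfolding a'_def using R \<eta> sqrt_sum_squares_le_sum[of R \<eta>] by simp
  ultimately have ab: "R - 2 * \<eta> \<le> b' - a'" by (simp add: b_def)
  have "R - 2 * \<eta> > 0" using \<eta> \<tau> R q(1) by (metis mult_pos_pos zero_less_mult_pos)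
  then have ab0: "b' - a' > 0" using ab by simp
  have qc: "1 / (q * (b' - a')) \<le> c"
  proof -
    have "1 / c \<le> q * (b' - a')" using \<eta>(2) ab q \<tau>(3) by (metis mult_left_mono less_imp_le)
    then show ?thesis using cpos q ab0 by (simp add: field_simps)
  qed
  obtain \<psi> where \<psi>: "\<And>k. Ck_on k UNIV \<psi>" "\<And>t. t \<le> 0 \<Longrightarrow> \<psi> t = 0" "\<And>t. t \<ge> 1 \<Longrightarrow> \<psi> t = 1"
    "\<And>t. 0 \<le> \<psi> t" "\<And>t. \<psi> t \<le> 1" "\<And>s t. \<bar>\<psi> s - \<psi> t\<bar> \<le> \<bar>s - t\<bar> / q"
    using smooth_step[OF q(1,2)] by metis
  define F where "F x = \<psi> ((b' - w x) / (b' - a'))" for x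
  show ?thesis
  proof (rule that[of b F])
    show "b < 2 * R" using \<eta> by (simp add: b_def)
    show "Ck_on k UNIV F" for k
    proof -
      have "Ck_on k UNIV (\<lambda>x :: 'a. (norm x)\<^sup>2 + \<eta>\<^sup>2)"
        using Ck_on_norm_squared[of k "0 :: 'a"] by (intro Ck_on_add Ck_on_const) auto
      then have "Ck_on k UNIV (\<lambda>x :: 'a. ((norm x)\<^sup>2 + \<eta>\<^sup>2) powr (1 / 2))"
        by (rule Ck_on_compose[of k "{0<..}" "\<lambda>t. t powr (1 / 2)" UNIV, OF Ck_on_powr]) (use \<eta> in \<open>auto simp: add_nonneg_pos\<close>)
      then have "Ck_on k UNIV w"
        by (rule Ck_on_cong) (auto simp: w_def powr_half_sqrt)
      then have "Ck_on k UNIV (\<lambda>x. b' / (b' - a') + (- 1 / (b' - a')) *\<^sub>R w x)"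
        by (intro Ck_on_add Ck_on_scaleR Ck_on_const) auto
      then have "Ck_on k UNIV (\<lambda>x. (b' - w x) / (b' - a'))"
        by (simp add: diff_divide_distrib)
      then show ?thesis
        unfolding F_def[abs_def]
        by (rule Ck_on_compose[of k UNIV \<psi> UNIV "\<lambda>x. (b' - w x) / (b' - a')", OF \<psi>(1)]) auto
    qed
    show "F x = 1" if "norm x \<le> R" for x
    proof -
      have "w x \<le> a'" unfolding w_def a'_def using that by (simp add: power_mono)
      then show ?thesis using ab0 unfolding F_def by (intro \<psi>(3)) simp
    qed
    show "F x = 0" if "norm x \<ge> b" for x
    proof -
      have "w x \<ge> b'" unfolding w_def b'_def using that b0 by (simp add: power_mono)
      then show ?thesis using ab0 unfolding F_def by (intro \<psi>(2)) (simp add: divide_nonpos_pos)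
    qed
    show "0 \<le> F x" "F x \<le> 1" for x using \<psi>(4,5) by (auto simp: F_def)
    show "\<bar>F x - F y\<bar> \<le> c * norm (x - y)" for x y
    proof -
      have "\<bar>w y - w x\<bar> \<le> norm (x - y)"
        unfolding w_norm using norm_triangle_ineq3[of "(y, \<eta>)" "(x, \<eta>)"] by (simp add: norm_minus_commute)
      then have "\<bar>(b' - w x) / (b' - a') - (b' - w y) / (b' - a')\<bar> \<le> norm (x - y) / (b' - a')"
        using ab0 by (simp add: divide_right_mono flip: diff_divide_distrib)
      then have "\<bar>F x - F y\<bar> \<le> norm (x - y) / (b' - a') / q"
        unfolding F_def using \<psi>(6) q by (meson divide_right_mono less_imp_le order_trans)
      also have "\<dots> = (1 / (q * (b' - a'))) * norm (x - y)" by simp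
      also have "\<dots> \<le> c * norm (x - y)" using qc by (rule mult_right_mono) simp
      finally show ?thesis .
    qed
  qed
qed

section \<open>Charts and the area measure\<close>

lemma half_space_openin_direction:
  fixes V :: "(real ^ 'n::finite) set"
  assumes V: "openin (top_of_set {y. 0 \<le> y $ k}) V" and "y \<in> V" "i \<in> Basis" "e > 0"
  shows "\<exists>d. 0 < \<bar>d\<bar> \<and> \<bar>d\<bar> < e \<and> y + d *\<^sub>R i \<in> V"
proof -
  obtain r where r: "r > 0" "ball y r \<inter> {y. 0 \<le> y $ k} \<subseteq> V"
    using V \<open>y \<in> V\<close> unfolding openin_contains_ball by blast
  have yk: "0 \<le> y $ k" using V \<open>y \<in> V\<close> openin_imp_subset by fastforce
  define d where "d = min e r / 2"
  have d: "0 < d" "d < e" "d < r" using r \<open>e > 0\<close> by (auto simp: d_def)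
  \<comment> \<open>Standard basis vectors have nonnegative coordinates, so a small positive step
    along them stays in the half-space even from a boundary point. Such steps in every basis
    direction make the derivative within \<open>V\<close> unique.\<close>
  have "i $ k \<ge> 0" using \<open>i \<in> Basis\<close> by (auto simp: Basis_vec_def axis_def)
  then have "y + d *\<^sub>R i \<in> ball y r \<inter> {y. 0 \<le> y $ k}"
    using d yk \<open>i \<in> Basis\<close> by (auto simp: dist_norm)
  then show ?thesis using r d by (intro exI[of _ d]) auto
qed

lemma half_space_derivative_unique:
  fixes V :: "(real ^ 'n::finite) set"
  assumes "openin (top_of_set {y. 0 \<le> y $ k}) V" "y \<in> V" "(f has_derivative f') (at y within V)"
  shows "frechet_derivative f (at y within V) = f'"
proof (rule frechet_derivative_unique_within)
  show "(f has_derivative frechet_derivative f (at y within V)) (at y within V)"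
    using assms(3) frechet_derivative_works differentiableI by blast
qed (use assms half_space_openin_direction in auto)

text \<open>Near \<open>a\<close> the derivative within \<open>V\<close> is that of a smooth
  extension to an open set, boundary points included; continuity of derivatives on \<open>V\<close>
  is inherited from the extension in this way.\<close>

lemma smooth_on_extension_derivative:
  fixes V :: "(real ^ 'n::finite) set"
  assumes V: "openin (top_of_set {y. 0 \<le> y $ k}) V" and f: "smooth_on V f" and a: "a \<in> V"
  obtains U g where "open U" "a \<in> U" "\<And>k. Ck_on k U g"
    "\<And>y. y \<in> V \<inter> U \<Longrightarrow> (f has_derivative frechet_derivative g (at y)) (at y within V)"
    "\<And>y. y \<in> V \<inter> U \<Longrightarrow> frechet_derivative f (at y within V) = frechet_derivative g (at y)"
proof -
  obtain U g where U: "open U" "a \<in> U" "\<And>k. Ck_on k U g" "\<forall>x\<in>V \<inter> U. g x = f x"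
    using f a unfolding smooth_on_def by metis
  have der: "(f has_derivative frechet_derivative g (at y)) (at y within V)" if y: "y \<in> V \<inter> U" for y
  proof -
    have "(g has_derivative frechet_derivative g (at y)) (at y within V)"
      using Ck_on_derivative[OF U(3,1)] y by (auto intro: has_derivative_at_withinI)
    moreover obtain e where "e > 0" "ball y e \<subseteq> U" using U(1) y openE by blast
    moreover have "g z = f z" if "z \<in> V" "dist z y < e" for z
    proof -
      have "z \<in> ball y e" using that(2) by (simp add: dist_commute)
      then show ?thesis using \<open>ball y e \<subseteq> U\<close> U(4) that(1) by blast
    qed
    ultimately show ?thesis
      using y by (blast intro: has_derivative_transform_within)
  qed
  show ?thesis
    by (rule that[OF U(1-3) der]) (use half_space_derivative_unique[OF V _ der] in auto)
qed

lemma smooth_on_has_derivative: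
  fixes V :: "(real ^ 'n::finite) set"
  assumes "openin (top_of_set {y. 0 \<le> y $ k}) V" "smooth_on V f" "y \<in> V"
  shows "(f has_derivative frechet_derivative f (at y within V)) (at y within V)"
  using smooth_on_extension_derivative[OF assms] assms(3) by (metis IntI)

lemma smooth_on_imp_continuous_on:
  fixes V :: "(real ^ 'n::finite) set"
  assumes "openin (top_of_set {y. 0 \<le> y $ k}) V" "smooth_on V f"
  shows "continuous_on V f"
  using smooth_on_has_derivative[OF assms] has_derivative_continuous continuous_on_eq_continuous_within
  by blast

lemma smooth_on_continuous_derivative:
  fixes V :: "(real ^ 'n::finite) set"
  assumes V: "openin (top_of_set {y. 0 \<le> y $ k}) V" and f: "smooth_on V f"
  shows "continuous_on V (\<lambda>y. frechet_derivative f (at y within V) v)"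
  unfolding continuous_on_eq_continuous_within
proof
  fix a assume a: "a \<in> V"
  obtain U g where U: "open U" "a \<in> U" "\<And>k. Ck_on k U g"
    "\<And>y. y \<in> V \<inter> U \<Longrightarrow> frechet_derivative f (at y within V) = frechet_derivative g (at y)"
    using smooth_on_extension_derivative[OF V f a] by metis
  have "continuous_on U (\<lambda>y. frechet_derivative g (at y) v)"
    using U(3)[of 1] by simp
  then have c: "continuous (at a within V) (\<lambda>y. frechet_derivative g (at y) v)"
    using U(1,2) continuous_on_eq_continuous_at continuous_at_imp_continuous_at_within by blast
  obtain e where "e > 0" "ball a e \<subseteq> U" using U(1,2) openE by blast
  show "continuous (at a within V) (\<lambda>y. frechet_derivative f (at y within V) v)"
  proof (rule continuous_transform_within[OF c \<open>e > 0\<close> a])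
    fix z assume "z \<in> V" "dist z a < e"
    then have "z \<in> V \<inter> U" using \<open>ball a e \<subseteq> U\<close> by (auto simp: dist_commute)
    then show "frechet_derivative g (at z) v = frechet_derivative f (at z within V) v"
      by (simp only: U(4))
  qed
qed

section \<open>Gram matrices of linear maps\<close>

definition gram :: "(real ^ 'n::finite \<Rightarrow> real ^ 'k::finite) \<Rightarrow> real ^ 'n ^ 'n" where
  "gram L = (\<chi> i j. L (axis i 1) \<bullet> L (axis j 1))"

lemma gram_eq_matrix: "gram L = transpose (matrix L) ** matrix L"
  by (intro vec_eq_iff[THEN iffD2] allI)
    (simp add: gram_def matrix_def transpose_def matrix_matrix_mult_def inner_vec_def)

text \<open>The transformation law of the metric under a coordinate change. Because the Jacobian
  determinant enters squared, the density sqrt(det g) changes by its absolute value.\<close>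

lemma det_gram_compose:
  assumes "linear L" "linear T"
  shows "det (gram (L \<circ> T)) = (det (matrix T))\<^sup>2 * det (gram L)"
proof -
  have "gram (L \<circ> T) = transpose (matrix T) ** gram L ** matrix T"
    by (simp only: gram_eq_matrix matrix_compose[OF assms(2,1)] matrix_transpose_mul matrix_mul_assoc)
  then show ?thesis
    by (simp add: det_mul power2_eq_square)
qed

lemma gram_mult_vector_inner:
  assumes "linear L"
  shows "(gram L *v w) \<bullet> z = L w \<bullet> L z"
proof -
  have L: "L x = matrix L *v x" for x
    using fun_cong[OF matrix_vector_mul(2)[OF assms], of x] by (rule sym)
  have "(gram L *v w) \<bullet> z = (transpose (matrix L) *v (matrix L *v w)) \<bullet> z"
    by (simp only: gram_eq_matrix matrix_vector_mul_assoc)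
  also have "\<dots> = (matrix L *v w) \<bullet> (matrix L *v z)"
    by (simp only: dot_lmul_matrix transpose_matrix_vector)
  finally show ?thesis by (simp only: L[symmetric])
qed

text \<open>A vector w in the kernel of the Gram matrix satisfies |L w|^2 = 0, hence w = 0 by
  injectivity.\<close>

lemma det_gram_nonzero:
  assumes "linear L" "inj L"
  shows "det (gram L) \<noteq> 0"
proof -
  have "w = 0" if "gram L *v w = 0" for w
    using gram_mult_vector_inner[OF assms(1), of w w] that assms linear_injective_0 by auto
  then have "inj ((*v) (gram L))"
    by (simp add: linear_injective_0)
  then show ?thesis
    by (metis det_nz_iff_inj matrix_of_matrix_vector_mul matrix_vector_mul_linear)
qed

section \<open>Charts and coordinate changes\<close>

locale immersed_surface =
  fixes S :: "('m, 'n::finite) hypersurface"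
  assumes immersed: "immersed_hypersurface S" and nonempty: "topspace (surf S) \<noteq> {}"
begin

abbreviation D :: "(real ^ 'n) set \<Rightarrow> (real ^ 'n \<Rightarrow> 'b::real_normed_vector) \<Rightarrow> real ^ 'n \<Rightarrow> real ^ 'n \<Rightarrow> 'b"
  where "D V f y \<equiv> frechet_derivative f (at y within V)"

lemma manifold: "smooth_manifold S"
  using immersed by (simp add: immersed_hypersurface_def)

context
  fixes V \<psi> assumes chart: "(V, \<psi>) \<in> params S"
begin

lemma chart_half_space: "\<exists>k. openin (top_of_set {y. 0 \<le> y $ k}) V"
  using manifold chart unfolding smooth_manifold_def by blast

lemma chart_open: "openin (surf S) (\<psi> ` V)"
  using manifold chart unfolding smooth_manifold_def by blast

lemma chart_homeo: "homeomorphic_map (top_of_set V) (subtopology (surf S) (\<psi> ` V)) \<psi>"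
  using manifold chart unfolding smooth_manifold_def by blast

lemma chart_inj: "inj_on \<psi> V"
  using homeomorphic_imp_injective_map[OF chart_homeo] by simp

lemma chart_topspace: "y \<in> V \<Longrightarrow> \<psi> y \<in> topspace (surf S)"
  using chart_open openin_subset by blast

lemma chart_continuous: "continuous_map (top_of_set V) (surf S) \<psi>"
  using homeomorphic_imp_continuous_map[OF chart_homeo] continuous_map_in_subtopology by blast

lemma chart_preimage_openin: "openin (surf S) U \<Longrightarrow> openin (top_of_set V) (V \<inter> \<psi> -` U)"
  using openin_continuous_map_preimage[OF chart_continuous] by (simp add: vimage_def Int_def)

lemma chart_image_openin: "openin (top_of_set V) U \<Longrightarrow> openin (surf S) (\<psi> ` U)"
  using homeomorphic_imp_open_map[OF chart_homeo] chart_open unfolding open_map_def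
  by (meson openin_trans_full)

lemma chart_borel: "V \<in> sets borel"
proof -
  obtain k where "openin (top_of_set {y. 0 \<le> y $ k}) V" using chart_half_space by blast
  then obtain T where "open T" "V = {y. 0 \<le> y $ k} \<inter> T" unfolding openin_open by blast
  moreover have "closed {y :: real ^ 'n. 0 \<le> y $ k}"
    by (intro closed_Collect_le continuous_intros)
  ultimately show ?thesis by (simp add: sets.Int borel_closed borel_open)
qed

lemma chart_smooth_has_derivative:
  assumes "smooth_on V f" "y \<in> V"
  shows "(f has_derivative D V f y) (at y within V)"
  using smooth_on_has_derivative[OF _ assms] chart_half_space by blast

lemma chart_continuous_derivative: "smooth_on V f \<Longrightarrow> continuous_on V (\<lambda>y. D V f y v)"
  using smooth_on_continuous_derivative chart_half_space by blast

lemma chart_continuous_on: "smooth_on V f \<Longrightarrow> continuous_on V f"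
  using smooth_on_imp_continuous_on chart_half_space by blast

lemma smooth_funD: "smooth_fun S f \<Longrightarrow> smooth_on V (f \<circ> \<psi>)"
  using chart unfolding smooth_fun_def by blast

lemma pos_smooth: "smooth_on V (pos S \<circ> \<psi>)"
  using immersed smooth_funD[of "pos S"] unfolding immersed_hypersurface_def by blast

lemma linear_D: "smooth_on V f \<Longrightarrow> y \<in> V \<Longrightarrow> linear (D V f y)"
  using chart_smooth_has_derivative has_derivative_linear by blast

lemma inj_D_pos: "y \<in> V \<Longrightarrow> inj (D V (pos S \<circ> \<psi>) y)"
  using immersed chart unfolding immersed_hypersurface_def by blast

lemma gram_det_eq: "gram_det S V \<psi> y = det (gram (D V (pos S \<circ> \<psi>) y))"
  by (simp add: gram_det_def gram_def Let_def)

lemma continuous_on_gram_det: "continuous_on V (gram_det S V \<psi>)"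
  unfolding gram_det_eq det_def gram_def vec_lambda_beta
  by (intro continuous_intros chart_continuous_derivative pos_smooth)

end

context
  fixes V \<psi> W \<theta> assumes c1: "(V, \<psi>) \<in> params S" and c2: "(W, \<theta>) \<in> params S"
begin

definition transition_domain where "transition_domain = V \<inter> \<psi> -` (\<theta> ` W)"
definition transition where "transition = the_inv_into W \<theta> \<circ> \<psi>"

lemma transition_domain_openin: "openin (top_of_set V) transition_domain"
  unfolding transition_domain_def using chart_preimage_openin[OF c1 chart_open[OF c2]] .

lemma transition_domain_half_space: "\<exists>k. openin (top_of_set {y. 0 \<le> y $ k}) transition_domain"
  using transition_domain_openin chart_half_space[OF c1] openin_trans by blast

lemma transition:
  assumes "y \<in> transition_domain"
  shows "transition y \<in> W" "\<theta> (transition y) = \<psi> y"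
proof -
  have "\<psi> y \<in> \<theta> ` W" using assms by (auto simp: transition_domain_def)
  then show "transition y \<in> W" "\<theta> (transition y) = \<psi> y"
    unfolding transition_def
    using the_inv_into_into[OF chart_inj[OF c2]] f_the_inv_into_f[OF chart_inj[OF c2]] by auto
qed

lemma transition_smooth: "smooth_on transition_domain transition"
  using manifold c1 c2 unfolding smooth_manifold_def transition_def transition_domain_def by blast

lemma transition_has_derivative:
  "y \<in> transition_domain \<Longrightarrow>
    (transition has_derivative D transition_domain transition y) (at y within transition_domain)"
  using smooth_on_has_derivative[OF _ transition_smooth] transition_domain_half_space by blast

text \<open>Both sides are derivatives of the same function within the transition domain, which is
  relatively open in a half-space, and derivatives there are unique.\<close>

lemma D_chart_change:
  assumes f: "smooth_fun S f" and y: "y \<in> transition_domain"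
  shows "D V (f \<circ> \<psi>) y = D W (f \<circ> \<theta>) (transition y) \<circ> D transition_domain transition y"
proof -
  let ?A = transition_domain
  have sub: "?A \<subseteq> V" and yV: "y \<in> V" using y by (auto simp: transition_domain_def)
  have 1: "(f \<circ> \<psi> has_derivative D V (f \<circ> \<psi>) y) (at y within ?A)"
    using chart_smooth_has_derivative[OF c1 smooth_funD[OF c1 f] yV] sub has_derivative_subset by blast
  have "(f \<circ> \<theta> has_derivative D W (f \<circ> \<theta>) (transition y)) (at (transition y) within transition ` ?A)"
    using chart_smooth_has_derivative[OF c2 smooth_funD[OF c2 f] transition(1)[OF y]] transition(1)
    by (metis has_derivative_subset image_subsetI)
  then have "((f \<circ> \<theta>) \<circ> transition has_derivative
      D W (f \<circ> \<theta>) (transition y) \<circ> D ?A transition y) (at y within ?A)"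
    by (rule diff_chain_within[OF transition_has_derivative[OF y]])
  then have 2: "(f \<circ> \<psi> has_derivative D W (f \<circ> \<theta>) (transition y) \<circ> D ?A transition y) (at y within ?A)"
    by (rule has_derivative_transform[rotated 2]) (use y transition(2) in auto)
  obtain k where "openin (top_of_set {y. 0 \<le> y $ k}) ?A" using transition_domain_half_space by blast
  from half_space_derivative_unique[OF this y 1] half_space_derivative_unique[OF this y 2]
  show ?thesis by simp
qed

lemma gram_det_chart_change:
  assumes y: "y \<in> transition_domain"
  shows "gram_det S V \<psi> y =
    (det (matrix (D transition_domain transition y)))\<^sup>2 * gram_det S W \<theta> (transition y)"
  unfolding gram_det_eq[OF c1] gram_det_eq[OF c2]
proof -
  have "smooth_fun S (pos S)" using immersed by (simp add: immersed_hypersurface_def)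
  from D_chart_change[OF this y] show "det (gram (D V (pos S \<circ> \<psi>) y)) =
    (det (matrix (D transition_domain transition y)))\<^sup>2 * det (gram (D W (pos S \<circ> \<theta>) (transition y)))"
    using linear_D[OF c2 pos_smooth[OF c2] transition(1)[OF y]]
      has_derivative_linear[OF transition_has_derivative[OF y]]
    by (simp add: det_gram_compose)
qed

end

section \<open>Existence, uniqueness and finiteness of the area measure\<close>

definition borel_surf :: "'m measure" where
  "borel_surf = sigma (topspace (surf S)) {U. openin (surf S) U}"

lemma space_borel_surf: "space borel_surf = topspace (surf S)"
  unfolding borel_surf_def by (rule space_measure_of) (auto dest: openin_subset)

lemma sets_borel_surf: "sets borel_surf = sigma_sets (topspace (surf S)) {U. openin (surf S) U}"
  unfolding borel_surf_def by (rule sets_measure_of) (auto dest: openin_subset)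

lemma openin_borel_surf: "openin (surf S) U \<Longrightarrow> U \<in> sets borel_surf"
  by (auto simp: sets_borel_surf)

lemma chart_measurable:
  assumes "(V, \<psi>) \<in> params S"
  shows "\<psi> \<in> restrict_space borel V \<rightarrow>\<^sub>M borel_surf"
  unfolding borel_surf_def
proof (rule measurable_measure_of)
  show "{U. openin (surf S) U} \<subseteq> Pow (topspace (surf S))" by (auto dest: openin_subset)
  show "\<psi> \<in> space (restrict_space borel V) \<rightarrow> topspace (surf S)"
    using chart_topspace[OF assms] by (auto simp: space_restrict_space)
  fix U assume "U \<in> {U. openin (surf S) U}"
  then have "openin (top_of_set V) (V \<inter> \<psi> -` U)" using chart_preimage_openin[OF assms] by simp
  then obtain T where T: "open T" "V \<inter> \<psi> -` U = V \<inter> T" unfolding openin_open by blast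
  then have "\<psi> -` U \<inter> space (restrict_space borel V) = V \<inter> T"
    by (simp add: space_restrict_space inf_commute)
  then show "\<psi> -` U \<inter> space (restrict_space borel V) \<in> sets (restrict_space borel V)"
    using T(1) by (simp add: sets_restrict_space)
qed

lemma chart_preimage_borel:
  assumes "(V, \<psi>) \<in> params S" "E \<in> sets borel_surf"
  shows "V \<inter> \<psi> -` E \<in> sets borel"
proof -
  have "\<psi> -` E \<inter> V \<in> sets (restrict_space borel V)"
    using measurable_sets[OF chart_measurable[OF assms(1)] assms(2)] by (simp add: space_restrict_space)
  then have "\<psi> -` E \<inter> V \<in> sets borel"
    using chart_borel[OF assms(1)] by (simp add: sets_restrict_space_iff)
  then show ?thesis
    by (simp only: Int_commute)
qed

text \<open>The area seen by one chart: only the part of \<open>E\<close> inside the image of the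
  chart is counted. In this form it is countably additive on all Borel sets.\<close>

definition chart_area where
  "chart_area V \<psi> E = (\<integral>\<^sup>+ y\<in>V \<inter> \<psi> -` E. ennreal (sqrt (gram_det S V \<psi> y)) \<partial>lborel)"

lemma gram_det_measurable:
  assumes c: "(V, \<psi>) \<in> params S" and "A \<in> sets borel" "A \<subseteq> V"
  shows "(\<lambda>y. ennreal (sqrt (gram_det S V \<psi> y)) * indicator A y) \<in> borel_measurable borel"
proof -
  have "continuous_on A (\<lambda>y. sqrt (gram_det S V \<psi> y))"
    by (intro continuous_intros continuous_on_subset[OF continuous_on_gram_det[OF c] assms(3)])
  then have "(\<lambda>y. ennreal (sqrt (gram_det S V \<psi> y))) \<in> borel_measurable (restrict_space borel A)"
    by (intro measurable_compose[OF borel_measurable_continuous_on_restrict]) auto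
  then show ?thesis
    using assms(2) by (subst (asm) borel_measurable_restrict_space_iff_ennreal) auto
qed

lemma chart_area_suminf:
  assumes c: "(V, \<psi>) \<in> params S" and F: "\<And>j. F j \<in> sets borel_surf" "disjoint_family F"
  shows "(\<Sum>j::nat. chart_area V \<psi> (F j)) = chart_area V \<psi> (\<Union>j. F j)"
proof -
  have ind: "(\<Sum>j. indicator (V \<inter> \<psi> -` F j) y) = (indicator (V \<inter> \<psi> -` (\<Union>j. F j)) y :: ennreal)" for y
  proof -
    have "disjoint_family (\<lambda>j. V \<inter> \<psi> -` F j)" using F(2) by (auto simp: disjoint_family_on_def)
    moreover have "(\<Union>j. V \<inter> \<psi> -` F j) = V \<inter> \<psi> -` (\<Union>j. F j)" by blast
    ultimately show ?thesis using suminf_indicator[of "\<lambda>j. V \<inter> \<psi> -` F j" y] by simp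
  qed
  have "(\<Sum>j. chart_area V \<psi> (F j)) =
      (\<integral>\<^sup>+ y. (\<Sum>j. ennreal (sqrt (gram_det S V \<psi> y)) * indicator (V \<inter> \<psi> -` F j) y) \<partial>lborel)"
    unfolding chart_area_def
    by (rule nn_integral_suminf[symmetric])
      (use gram_det_measurable[OF c chart_preimage_borel[OF c F(1)]] in auto)
  also have "\<dots> = chart_area V \<psi> (\<Union>j. F j)"
    unfolding chart_area_def by (simp add: ind)
  finally show ?thesis .
qed

text \<open>The transition map carries one chart preimage of \<open>E\<close> onto the other, and
  its Jacobian factor is absorbed by the transformation law of the Gram determinant.\<close>

lemma chart_area_consistent:
  assumes c: "(V, \<psi>) \<in> params S" "(W, \<theta>) \<in> params S"
    and E: "E \<in> sets borel_surf" "E \<subseteq> \<psi> ` V" "E \<subseteq> \<theta> ` W"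
  shows "chart_area V \<psi> E = chart_area W \<theta> E"
proof -
  let ?A = "transition_domain V \<psi> W \<theta>"
  let ?\<tau> = "transition \<psi> W \<theta>"
  define G where "G = V \<inter> \<psi> -` E"
  have GA: "G \<subseteq> ?A" using E by (auto simp: G_def transition_domain_def[OF c])
  have \<tau>: "?\<tau> y \<in> W" "\<theta> (?\<tau> y) = \<psi> y" if "y \<in> G" for y
    using transition[OF c] GA that by auto
  have img: "?\<tau> ` G = W \<inter> \<theta> -` E"
  proof (intro equalityI subsetI)
    fix z assume z: "z \<in> W \<inter> \<theta> -` E"
    then obtain y where y: "y \<in> V" "\<psi> y = \<theta> z" using E by force
    then have "y \<in> G" using z by (simp add: G_def)
    then have "?\<tau> y = z" using \<tau>[of y] y z chart_inj[OF c(2)] by (auto simp: inj_on_def)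
    then show "z \<in> ?\<tau> ` G" using \<open>y \<in> G\<close> by blast
  qed (use \<tau> in \<open>auto simp: G_def\<close>)
  have G: "G \<in> sets borel" unfolding G_def by (rule chart_preimage_borel[OF c(1) E(1)])
  have H: "W \<inter> \<theta> -` E \<in> sets borel" by (rule chart_preimage_borel[OF c(2) E(1)])
  \<comment> \<open>The change of variables formula asks for a globally defined, nonnegative Borel
    function. Extension by 0 and clipping at 0 leave the integral unchanged, as
    \<open>ennreal\<close> sends negative numbers to 0.\<close>
  define f where "f z = (if z \<in> W \<inter> \<theta> -` E then max 0 (sqrt (gram_det S W \<theta> z)) else 0)" for z
  let ?J = "\<lambda>y. det (matrix (D ?A ?\<tau> y))"
  have f_ind: "ennreal (f z) * indicator (W \<inter> \<theta> -` E) z =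
      ennreal (sqrt (gram_det S W \<theta> z)) * indicator (W \<inter> \<theta> -` E) z" for z
    by (simp add: f_def max_def ennreal_neg indicator_def)
  \<comment> \<open>Jacobian factor times target density is the source density. The identity also
    supplies the Borel measurability that the change of variables formula requires.\<close>
  have J_ind: "ennreal (\<bar>?J y\<bar> * f (?\<tau> y)) * indicator G y =
      ennreal (sqrt (gram_det S V \<psi> y)) * indicator G y" for y
  proof (cases "y \<in> G")
    case True
    then have "sqrt (gram_det S V \<psi> y) = \<bar>?J y\<bar> * sqrt (gram_det S W \<theta> (?\<tau> y))"
      using gram_det_chart_change[OF c] GA by (auto simp: real_sqrt_mult)
    moreover have "?\<tau> y \<in> W \<inter> \<theta> -` E" using img True by blast
    ultimately show ?thesis
      using True by (auto simp: f_def max_def mult_nonneg_nonpos ennreal_neg)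
  qed simp
  have "f \<in> borel_measurable borel"
  proof -
    have "continuous_on (W \<inter> \<theta> -` E) (\<lambda>z. max 0 (sqrt (gram_det S W \<theta> z)))"
      by (intro continuous_intros continuous_on_subset[OF continuous_on_gram_det[OF c(2)]]) auto
    then show ?thesis
      unfolding f_def[abs_def] using H by (intro borel_measurable_continuous_on_if) auto
  qed
  then have "(\<integral>\<^sup>+z\<in>?\<tau> ` G. ennreal (f z) \<partial>lborel) = (\<integral>\<^sup>+y\<in>G. ennreal (\<bar>?J y\<bar> * f (?\<tau> y)) \<partial>lborel)"
  proof (intro nn_integral_change_of_variables)
    show "(?\<tau> has_derivative D ?A ?\<tau> y) (at y within G)" if "y \<in> G" for y
      using transition_has_derivative[OF c] GA that by (blast intro: has_derivative_subset)
    show "inj_on ?\<tau> G"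
      using \<tau>(2) chart_inj[OF c(1)] unfolding inj_on_def G_def by (metis IntD1)
    show "(\<lambda>y. ennreal (\<bar>?J y\<bar> * f (?\<tau> y)) * indicator G y) \<in> borel_measurable borel"
      unfolding J_ind by (rule gram_det_measurable[OF c(1) G]) (auto simp: G_def)
    show "f y \<ge> 0" for y by (simp add: f_def)
  qed (use G H img in auto)
  then show ?thesis
    by (simp only: J_ind img f_ind chart_area_def flip: G_def)
qed

text \<open>Second countability gives the Lindelof property, which thins the atlas to countably many
  charts, so that countable additivity can glue them.\<close>

lemma countable_chart_cover:
  "\<exists>c :: nat \<Rightarrow> (real ^ 'n) set \<times> (real ^ 'n \<Rightarrow> 'm).
    range c \<subseteq> params S \<and> (\<Union>i. snd (c i) ` fst (c i)) = topspace (surf S)"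
proof -
  have cov: "(\<Union>(V, \<psi>)\<in>params S. \<psi> ` V) = topspace (surf S)"
    using manifold unfolding smooth_manifold_def by (elim conjE)
  have "second_countable (surf S)"
    using manifold unfolding smooth_manifold_def by (elim conjE)
  then have Lin: "Lindelof_space (surf S)"
    by (rule second_countable_imp_Lindelof_space)
  have op: "openin (surf S) U" if "U \<in> (\<lambda>(V, \<psi>). \<psi> ` V) ` params S" for U
    using that chart_open by auto
  obtain \<V> where \<V>: "countable \<V>" "\<V> \<subseteq> (\<lambda>(V, \<psi>). \<psi> ` V) ` params S" "\<Union>\<V> = topspace (surf S)"
    using Lindelof_spaceD[OF Lin op cov] by auto
  then obtain C where C: "C \<subseteq> params S" "countable C" "\<V> = (\<lambda>(V, \<psi>). \<psi> ` V) ` C"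
    using countable_subset_image[of \<V> "\<lambda>(V, \<psi>). \<psi> ` V" "params S"] by metis
  have UC: "(\<Union>c\<in>C. snd c ` fst c) = topspace (surf S)"
    unfolding \<V>(3)[symmetric] C(3) by (simp add: case_prod_unfold)
  \<comment> \<open>An empty family of charts could not be listed by the natural numbers;
    nonemptiness of the surface excludes it.\<close>
  then have "C \<noteq> {}" using nonempty by blast
  then have rng: "range (from_nat_into C) = C" by (rule range_from_nat_into[OF _ C(2)])
  show ?thesis
  proof (intro exI conjI)
    show "range (from_nat_into C) \<subseteq> params S" using rng C(1) by simp
    have "(\<Union>c\<in>range (from_nat_into C). snd c ` fst c) = topspace (surf S)"
      by (simp only: rng UC)
    then show "(\<Union>i. snd (from_nat_into C i) ` fst (from_nat_into C i)) = topspace (surf S)"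
      by (simp only: image_image)
  qed
qed

definition area_like :: "'m measure \<Rightarrow> bool" where
  "area_like m \<longleftrightarrow> space m = topspace (surf S) \<and>
     sets m = sigma_sets (topspace (surf S)) {U. openin (surf S) U} \<and>
     (\<forall>(V, \<psi>)\<in>params S. \<forall>E\<in>sets m. E \<subseteq> \<psi> ` V \<longrightarrow> emeasure m E = chart_area V \<psi> E)"

text \<open>A countable chart cover is made disjoint, and the measure of a set is the sum of the
  chart areas of its pieces. Consistency between charts gives the prescribed density in every chart.
  Any other such measure has the same values on the pieces and hence, by countable additivity,
  everywhere.\<close>

lemma ex1_area_like: "\<exists>!m. area_like m"
proof -
  obtain c :: "nat \<Rightarrow> (real ^ 'n) set \<times> (real ^ 'n \<Rightarrow> 'm)"
    where c: "range c \<subseteq> params S" "(\<Union>i. snd (c i) ` fst (c i)) = topspace (surf S)"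
    using countable_chart_cover by blast
  define V where "V i = fst (c i)" for i
  define \<psi> where "\<psi> i = snd (c i)" for i
  have ch: "(V i, \<psi> i) \<in> params S" for i
    using c(1) by (auto simp: V_def \<psi>_def)
  define P where "P = disjointed (\<lambda>i. \<psi> i ` V i)"
  have P_sets: "P i \<in> sets borel_surf" for i
    using sets.range_disjointed_sets[of "\<lambda>i. \<psi> i ` V i" borel_surf] openin_borel_surf chart_open[OF ch]
    by (auto simp: P_def)
  have P_sub: "P i \<subseteq> \<psi> i ` V i" for i
    unfolding P_def by (auto simp: disjointed_def)
  have P_disj: "disjoint_family P" by (simp add: P_def disjoint_family_disjointed)
  have P_UN: "(\<Union>i. P i) = topspace (surf S)"
    using c(2) by (simp add: P_def UN_disjointed_eq V_def \<psi>_def)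
  have E_UN: "(\<Union>i. E \<inter> P i) = E" if "E \<in> sets borel_surf" for E
    using P_UN sets.sets_into_space[OF that] by (auto simp: space_borel_surf)
  have E_disj: "disjoint_family (\<lambda>i. E \<inter> P i)" for E
    using P_disj by (auto simp: disjoint_family_on_def)
  define \<mu> where "\<mu> E = (\<Sum>i. chart_area (V i) (\<psi> i) (E \<inter> P i))" for E
  define m where "m = measure_of (topspace (surf S)) {U. openin (surf S) U} \<mu>"
  have Pow: "{U. openin (surf S) U} \<subseteq> Pow (topspace (surf S))" by (auto dest: openin_subset)
  have space_m: "space m = topspace (surf S)" unfolding m_def using Pow by (rule space_measure_of)
  have sets_m: "sets m = sets borel_surf"
    unfolding m_def sets_borel_surf using Pow by (rule sets_measure_of)
  have em: "emeasure m E = \<mu> E" if E: "E \<in> sets m" for E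
  proof (rule emeasure_measure_of[OF m_def Pow _ _ E])
    show "positive (sets m) \<mu>"
      by (simp add: positive_def \<mu>_def chart_area_def)
    show "countably_additive (sets m) \<mu>"
    proof (rule countably_additiveI)
      fix F :: "nat \<Rightarrow> 'm set"
      assume F: "range F \<subseteq> sets m" "disjoint_family F" "(\<Union>j. F j) \<in> sets m"
      \<comment> \<open>One of the two series is written as an integral over a counting measure, so
        interchanging the sums becomes exchanging an integral with a series.\<close>
      have "(\<Sum>j. \<mu> (F j)) = (\<integral>\<^sup>+j. (\<Sum>i. chart_area (V i) (\<psi> i) (F j \<inter> P i)) \<partial>count_space UNIV)"
        by (simp add: \<mu>_def nn_integral_count_space_nat)
      also have "\<dots> = (\<Sum>i. \<integral>\<^sup>+j. chart_area (V i) (\<psi> i) (F j \<inter> P i) \<partial>count_space UNIV)"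
        by (rule nn_integral_suminf) simp
      also have "\<dots> = (\<Sum>i. \<Sum>j. chart_area (V i) (\<psi> i) (F j \<inter> P i))"
        by (simp add: nn_integral_count_space_nat)
      also have "\<dots> = (\<Sum>i. chart_area (V i) (\<psi> i) (\<Union>j. F j \<inter> P i))"
      proof (rule suminf_cong, rule chart_area_suminf[OF ch])
        show "F j \<inter> P i \<in> sets borel_surf" for i j
          using F(1) P_sets by (auto simp: sets_m)
        show "disjoint_family (\<lambda>j. F j \<inter> P i)" for i
          using F(2) by (auto simp: disjoint_family_on_def)
      qed
      also have "\<dots> = \<mu> (\<Union>j. F j)" by (simp add: \<mu>_def)
      finally show "(\<Sum>j. \<mu> (F j)) = \<mu> (\<Union>j. F j)" .
    qed
  qed
  have like_m: "area_like m"
    unfolding area_like_def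
  proof (safe)
    fix W \<theta> E assume W: "(W, \<theta>) \<in> params S" and E: "E \<in> sets m" "E \<subseteq> \<theta> ` W"
    have "chart_area (V i) (\<psi> i) (E \<inter> P i) = chart_area W \<theta> (E \<inter> P i)" for i
      using chart_area_consistent[OF ch W, of "E \<inter> P i" i] E P_sub P_sets by (auto simp: sets_m)
    then have "emeasure m E = (\<Sum>i. chart_area W \<theta> (E \<inter> P i))"
      using em[OF E(1)] by (simp add: \<mu>_def)
    also have "\<dots> = chart_area W \<theta> (\<Union>i. E \<inter> P i)"
      by (rule chart_area_suminf[OF W _ E_disj]) (use E P_sets in \<open>auto simp: sets_m\<close>)
    also have "(\<Union>i. E \<inter> P i) = E" using E_UN E by (simp add: sets_m)
    finally show "emeasure m E = chart_area W \<theta> E" .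
  qed (auto simp: space_m sets_m sets_borel_surf)
  have "m1 = m2" if m1: "area_like m1" and m2: "area_like m2" for m1 m2
  proof (rule measure_eqI)
    have sets12: "sets m1 = sets borel_surf" "sets m2 = sets borel_surf"
      using m1 m2 by (auto simp: area_like_def sets_borel_surf)
    then show "sets m1 = sets m2" by simp
    have ev: "emeasure m' E = (\<Sum>i. chart_area (V i) (\<psi> i) (E \<inter> P i))"
      if m': "area_like m'" and E: "E \<in> sets borel_surf" for m' E
    proof -
      have s: "sets m' = sets borel_surf" using m' by (auto simp: area_like_def sets_borel_surf)
      have "(\<Sum>i. emeasure m' (E \<inter> P i)) = emeasure m' (\<Union>i. E \<inter> P i)"
        by (rule suminf_emeasure[OF _ E_disj]) (use E P_sets in \<open>auto simp: s\<close>)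
      moreover have "emeasure m' (E \<inter> P i) = chart_area (V i) (\<psi> i) (E \<inter> P i)" for i
      proof -
        have "\<forall>(V, \<psi>)\<in>params S. \<forall>E\<in>sets m'. E \<subseteq> \<psi> ` V \<longrightarrow> emeasure m' E = chart_area V \<psi> E"
          using m' unfolding area_like_def by (elim conjE)
        moreover have "E \<inter> P i \<in> sets m'" "E \<inter> P i \<subseteq> \<psi> i ` V i"
          using E P_sets[of i] P_sub[of i] by (auto simp: s)
        ultimately show ?thesis using ch[of i] by (auto dest!: bspec)
      qed
      ultimately show ?thesis using E_UN[OF E] by simp
    qed
    show "emeasure m1 E = emeasure m2 E" if "E \<in> sets m1" for E
      using ev[OF m1] ev[OF m2] that sets12 by simp
  qed
  then show ?thesis using like_m by (intro ex1I[of area_like m])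
qed

lemma area_like_area: "area_like (area S)"
proof -
  have "area S = (THE m. area_like m)"
    unfolding area_def area_like_def chart_area_def by simp
  then show ?thesis using theI'[OF ex1_area_like] by simp
qed

lemma space_area: "space (area S) = topspace (surf S)"
  and sets_area: "sets (area S) = sets borel_surf"
  using area_like_area by (auto simp: area_like_def sets_borel_surf)

lemma emeasure_area_chart:
  "(V, \<psi>) \<in> params S \<Longrightarrow> E \<in> sets borel_surf \<Longrightarrow> E \<subseteq> \<psi> ` V \<Longrightarrow> emeasure (area S) E = chart_area V \<psi> E"
  using area_like_area unfolding area_like_def sets_borel_surf by blast

text \<open>The density is continuous in a chart, hence bounded near the given point, and the image
  of a small relatively open ball is open in the surface.\<close>

lemma locally_finite_area:
  assumes "p \<in> topspace (surf S)"
  obtains U where "openin (surf S) U" "p \<in> U" "emeasure (area S) U < \<infinity>"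
proof -
  obtain V \<psi> y where c: "(V, \<psi>) \<in> params S" and y: "y \<in> V" "p = \<psi> y"
    using manifold assms unfolding smooth_manifold_def by blast
  obtain e where e: "e > 0" "\<And>z. z \<in> V \<Longrightarrow> dist z y < e \<Longrightarrow> dist (gram_det S V \<psi> z) (gram_det S V \<psi> y) < 1"
    using continuous_on_gram_det[OF c] y(1) unfolding continuous_on_iff by (metis zero_less_one)
  define K where "K = sqrt (\<bar>gram_det S V \<psi> y\<bar> + 1)"
  define U where "U = \<psi> ` (V \<inter> ball y e)"
  have U: "openin (surf S) U"
    unfolding U_def by (rule chart_image_openin[OF c]) (simp add: openin_open_Int)
  have "emeasure (area S) U = chart_area V \<psi> U"
    using emeasure_area_chart[OF c openin_borel_surf[OF U]] by (auto simp: U_def)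
  also have "\<dots> \<le> (\<integral>\<^sup>+z. ennreal K * indicator (ball y e) z \<partial>lborel)"
    unfolding chart_area_def
  proof (rule nn_integral_mono)
    fix z
    show "ennreal (sqrt (gram_det S V \<psi> z)) * indicator (V \<inter> \<psi> -` U) z \<le> ennreal K * indicator (ball y e) z"
    proof (cases "z \<in> V \<inter> \<psi> -` U")
      case True
      then have z: "z \<in> V" "z \<in> ball y e"
        using chart_inj[OF c] by (auto simp: U_def inj_on_def)
      then have "gram_det S V \<psi> z \<le> \<bar>gram_det S V \<psi> y\<bar> + 1"
        using e(2)[of z] by (auto simp: dist_commute dist_real_def)
      then show ?thesis using z by (simp add: K_def ennreal_leI indicator_def)
    qed simp
  qed
  also have "\<dots> = ennreal K * emeasure lborel (ball y e)"
    by (simp add: nn_integral_cmult_indicator)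
  also have "\<dots> < \<infinity>"
    using emeasure_lborel_ball_finite[of y e] by (simp add: ennreal_mult_less_top)
  finally show ?thesis
    using that[OF U] y e(1) by (auto simp: U_def)
qed

lemma finite_area:
  assumes "compact_space (surf S)"
  shows "emeasure (area S) (topspace (surf S)) < \<infinity>"
proof -
  define \<U> where "\<U> = {U. openin (surf S) U \<and> emeasure (area S) U < \<infinity>}"
  have "topspace (surf S) \<subseteq> \<Union>\<U>"
  proof
    fix p assume "p \<in> topspace (surf S)"
    from locally_finite_area[OF this] show "p \<in> \<Union>\<U>" unfolding \<U>_def by blast
  qed
  then obtain \<F> where F: "finite \<F>" "\<F> \<subseteq> \<U>" "topspace (surf S) \<subseteq> \<Union>\<F>"
    using compactinD[of "surf S" "topspace (surf S)" \<U>] assms by (auto simp: compact_space_def \<U>_def)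
  moreover have "U \<subseteq> topspace (surf S)" if "U \<in> \<F>" for U
    using that F(2) openin_subset unfolding \<U>_def by blast
  ultimately have "\<Union>\<F> = topspace (surf S)"
    by (intro equalityI Union_least)
  have "emeasure (area S) (\<Union>U\<in>\<F>. U) \<le> (\<Sum>U\<in>\<F>. emeasure (area S) U)"
    by (rule emeasure_subadditive_finite)
      (use F openin_borel_surf in \<open>auto simp: \<U>_def sets_area\<close>)
  also have "\<dots> < \<infinity>"
    using F by (auto simp: \<U>_def ennreal_sum_less_top)
  finally show ?thesis using \<open>\<Union>\<F> = topspace (surf S)\<close> by simp
qed

end

section \<open>Gradient and second fundamental form\<close>

context immersed_surface
begin

section \<open>Derivatives along the hypersurface and their independence of the chart\<close>

lemma continuous_map_chartsI:
  fixes f :: "'m \<Rightarrow> 'b::topological_space"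
  assumes "\<And>V \<psi>. (V, \<psi>) \<in> params S \<Longrightarrow> continuous_on V (\<lambda>y. f (\<psi> y))"
  shows "continuous_map (surf S) euclidean f"
  unfolding continuous_map_def
proof (intro conjI allI impI)
  have cov: "(\<Union>(V, \<psi>)\<in>params S. \<psi> ` V) = topspace (surf S)"
    using manifold unfolding smooth_manifold_def by (elim conjE)
  fix U :: "'b set" assume "openin euclidean U"
  then have U: "open U" by simp
  have "openin (surf S) (\<psi> ` (V \<inter> (\<lambda>y. f (\<psi> y)) -` U))" if c: "(V, \<psi>) \<in> params S" for V \<psi>
    using assms[OF c] U by (intro chart_image_openin[OF c]) (simp add: continuous_openin_preimage_gen)
  then have "openin (surf S) (\<Union>(V, \<psi>)\<in>params S. \<psi> ` (V \<inter> (\<lambda>y. f (\<psi> y)) -` U))"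
    by (intro openin_Union) auto
  moreover have "(\<Union>(V, \<psi>)\<in>params S. \<psi> ` (V \<inter> (\<lambda>y. f (\<psi> y)) -` U)) = {p \<in> topspace (surf S). f p \<in> U}"
    unfolding cov[symmetric] by auto
  ultimately show "openin (surf S) {p \<in> topspace (surf S). f p \<in> U}" by simp
qed simp

lemma smooth_fun_continuous_map: "smooth_fun S f \<Longrightarrow> continuous_map (surf S) euclidean f"
  using chart_continuous_on[OF _ smooth_funD] by (intro continuous_map_chartsI) (auto simp: o_def)

lemma pos_smooth_fun: "smooth_fun S (pos S)"
  using immersed by (simp add: immersed_hypersurface_def)

lemma chart_at:
  assumes "p \<in> topspace (surf S)"
  obtains V \<psi> y where "(V, \<psi>) \<in> params S" "y \<in> V" "p = \<psi> y"
  using manifold assms unfolding smooth_manifold_def by blast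

lemma param_at:
  assumes "p \<in> topspace (surf S)"
  obtains V \<psi> where "param_at S p = (V, \<psi>)" "(V, \<psi>) \<in> params S" "p \<in> \<psi> ` V"
proof -
  obtain V \<psi> y where "(V, \<psi>) \<in> params S" "y \<in> V" "p = \<psi> y" using chart_at[OF assms] .
  then have "\<exists>c. case c of (V, \<psi>) \<Rightarrow> (V, \<psi>) \<in> params S \<and> p \<in> \<psi> ` V" by auto
  then have "case param_at S p of (V, \<psi>) \<Rightarrow> (V, \<psi>) \<in> params S \<and> p \<in> \<psi> ` V"
    unfolding param_at_def by (rule someI_ex)
  then show ?thesis using that by (cases "param_at S p") auto
qed

text \<open>\<open>coord_deriv\<close> uses whichever chart \<open>param_at\<close> selects. The
  differential \<open>T\<close> of the transition from that chart to the given one is injective,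
  hence bijective. By the chain rule it cancels between the derivative of the function and the
  inverse of the derivative of the position.\<close>

lemma chart_derivatives:
  assumes c: "(V, \<psi>) \<in> params S" and y: "y \<in> V"
  shows tangent_space_chart: "tangent_space S (\<psi> y) = range (D V (pos S \<circ> \<psi>) y)"
    and dir_deriv_chart: "smooth_fun S f \<Longrightarrow> dir_deriv S (D V (pos S \<circ> \<psi>) y w) f (\<psi> y) = D V (f \<circ> \<psi>) y w"
proof -
  obtain W \<theta> where W: "param_at S (\<psi> y) = (W, \<theta>)" "(W, \<theta>) \<in> params S" "\<psi> y \<in> \<theta> ` W"
    using param_at chart_topspace[OF c y] by metis
  define z where "z = the_inv_into W \<theta> (\<psi> y)"
  have z: "z \<in> W" "\<theta> z = \<psi> y"
    using W chart_inj[OF W(2)] by (auto simp: z_def the_inv_into_into f_the_inv_into_f)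
  have dom: "z \<in> transition_domain W \<theta> V \<psi>"
    using z y by (auto simp: transition_domain_def[OF W(2) c])
  have "transition \<theta> V \<psi> z = y"
    using transition[OF W(2) c dom] z y chart_inj[OF c] by (auto simp: inj_on_def)
  then have chain: "D W (f \<circ> \<theta>) z = D V (f \<circ> \<psi>) y \<circ> D (transition_domain W \<theta> V \<psi>) (transition \<theta> V \<psi>) z"
    if "smooth_fun S f" for f :: "'m \<Rightarrow> 'd::real_normed_vector"
    using D_chart_change[OF W(2) c that dom] by simp
  have cd: "coord_deriv S f (\<psi> y) = D W (f \<circ> \<theta>) z" for f :: "'m \<Rightarrow> 'd::real_normed_vector"
    by (simp add: coord_deriv_def W(1) z_def)
  define T where "T = D (transition_domain W \<theta> V \<psi>) (transition \<theta> V \<psi>) z"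
  have linT: "linear T"
    unfolding T_def using has_derivative_linear[OF transition_has_derivative[OF W(2) c dom]] .
  have "inj (D V (pos S \<circ> \<psi>) y \<circ> T)"
    using inj_D_pos[OF W(2) z(1)] chain[OF pos_smooth_fun] by (simp add: T_def)
  then have "inj T" by (rule inj_on_imageI2)
  then have surj: "surj T" using linT linear_injective_imp_surjective by blast
  show "tangent_space S (\<psi> y) = range (D V (pos S \<circ> \<psi>) y)"
    unfolding tangent_space_def cd chain[OF pos_smooth_fun] T_def[symmetric]
    by (metis surj image_comp)
  assume f: "smooth_fun S f"
  obtain u where u: "w = T u" using surj by (metis surjD)
  have "coord_deriv S (pos S) (\<psi> y) u = D V (pos S \<circ> \<psi>) y w"
    by (simp add: cd chain[OF pos_smooth_fun] T_def u)
  moreover have "inj (coord_deriv S (pos S) (\<psi> y))"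
    unfolding cd by (rule inj_D_pos[OF W(2) z(1)])
  ultimately have "the_inv (coord_deriv S (pos S) (\<psi> y)) (D V (pos S \<circ> \<psi>) y w) = u"
    by (metis the_inv_f_f)
  then show "dir_deriv S (D V (pos S \<circ> \<psi>) y w) f (\<psi> y) = D V (f \<circ> \<psi>) y w"
    by (simp add: dir_deriv_def cd chain[OF f] T_def u)
qed

lemma subspace_tangent_space:
  assumes "p \<in> topspace (surf S)"
  shows "subspace (tangent_space S p)"
proof -
  obtain V \<psi> y where c: "(V, \<psi>) \<in> params S" "y \<in> V" "p = \<psi> y" using chart_at[OF assms] .
  show ?thesis
    unfolding c(3) tangent_space_chart[OF c(1,2)]
    using linear_D[OF c(1) pos_smooth[OF c(1)] c(2)] by (simp add: linear_subspace_image)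
qed

text \<open>The inverse inside \<open>dir_deriv\<close> is meaningful on tangent vectors only, so
  linearity is stated for combinations of these.\<close>

lemma linear_dir_deriv:
  assumes p: "p \<in> topspace (surf S)" and f: "smooth_fun S f" and E: "finite I" "\<And>i. i \<in> I \<Longrightarrow> v i \<in> tangent_space S p"
  shows "dir_deriv S (\<Sum>i\<in>I. a i *\<^sub>R v i) f p = (\<Sum>i\<in>I. a i *\<^sub>R dir_deriv S (v i) f p)"
proof -
  obtain V \<psi> y where c: "(V, \<psi>) \<in> params S" "y \<in> V" "p = \<psi> y" using chart_at[OF p] .
  have "\<forall>i\<in>I. \<exists>w. v i = D V (pos S \<circ> \<psi>) y w"
    using E(2) unfolding c(3) tangent_space_chart[OF c(1,2)] by blast
  then obtain w where w: "\<And>i. i \<in> I \<Longrightarrow> v i = D V (pos S \<circ> \<psi>) y (w i)" by metis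
  interpret X: linear "D V (pos S \<circ> \<psi>) y" using linear_D[OF c(1) pos_smooth[OF c(1)] c(2)] .
  interpret F: linear "D V (f \<circ> \<psi>) y" using linear_D[OF c(1) smooth_funD[OF c(1) f] c(2)] .
  have "(\<Sum>i\<in>I. a i *\<^sub>R v i) = D V (pos S \<circ> \<psi>) y (\<Sum>i\<in>I. a i *\<^sub>R w i)"
    by (simp add: X.sum X.scale w)
  then have "dir_deriv S (\<Sum>i\<in>I. a i *\<^sub>R v i) f p = D V (f \<circ> \<psi>) y (\<Sum>i\<in>I. a i *\<^sub>R w i)"
    by (simp only: c(3) dir_deriv_chart[OF c(1,2) f])
  also have "\<dots> = (\<Sum>i\<in>I. a i *\<^sub>R dir_deriv S (v i) f p)"
    by (simp add: F.sum F.scale c(3) dir_deriv_chart[OF c(1,2) f] w)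
  finally show ?thesis .
qed

lemma tangent_onb:
  assumes "p \<in> topspace (surf S)"
  shows tangent_onb_orthogonal: "pairwise orthogonal (tangent_onb S p)"
    and tangent_onb_norm: "e \<in> tangent_onb S p \<Longrightarrow> norm e = 1"
    and span_tangent_onb: "span (tangent_onb S p) = tangent_space S p"
    and finite_tangent_onb: "finite (tangent_onb S p)"
proof -
  obtain B where "pairwise orthogonal B" "\<And>x. x \<in> B \<Longrightarrow> norm x = 1" "span B = tangent_space S p"
    using orthonormal_basis_subspace[OF subspace_tangent_space[OF assms]] by metis
  then have "\<exists>E. pairwise orthogonal E \<and> (\<forall>e\<in>E. norm e = 1) \<and> span E = tangent_space S p" by blast
  then have *: "pairwise orthogonal (tangent_onb S p) \<and> (\<forall>e\<in>tangent_onb S p. norm e = 1) \<and>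
      span (tangent_onb S p) = tangent_space S p"
    unfolding tangent_onb_def by (rule someI_ex)
  then show "pairwise orthogonal (tangent_onb S p)" "e \<in> tangent_onb S p \<Longrightarrow> norm e = 1"
    "span (tangent_onb S p) = tangent_space S p" by auto
  have "0 \<notin> tangent_onb S p" using * by force
  then show "finite (tangent_onb S p)"
    using * pairwise_orthogonal_independent independent_imp_finite by blast
qed

lemma tangent_onb_expand:
  assumes "p \<in> topspace (surf S)" "v \<in> tangent_space S p"
  shows "(\<Sum>e\<in>tangent_onb S p. (v \<bullet> e) *\<^sub>R e) = v"
  using orthonormal_basis_expand[OF tangent_onb(1,2)[OF assms(1)] _ tangent_onb(4)[OF assms(1)]]
    assms span_tangent_onb by auto

lemma norm_sum_tangent_onb:
  assumes "p \<in> topspace (surf S)"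
  shows "(norm (\<Sum>e\<in>tangent_onb S p. a e *\<^sub>R e))\<^sup>2 = (\<Sum>e\<in>tangent_onb S p. (a e)\<^sup>2)"
proof -
  have "(norm (\<Sum>e\<in>tangent_onb S p. a e *\<^sub>R e))\<^sup>2 = (\<Sum>e\<in>tangent_onb S p. (norm (a e *\<^sub>R e))\<^sup>2)"
    by (rule norm_sum_Pythagorean[OF finite_tangent_onb[OF assms]])
      (use tangent_onb_orthogonal[OF assms] in \<open>auto simp: pairwise_def orthogonal_def\<close>)
  then show ?thesis using tangent_onb_norm[OF assms] by simp
qed

lemma tangent_onb_tangent: "p \<in> topspace (surf S) \<Longrightarrow> e \<in> tangent_onb S p \<Longrightarrow> e \<in> tangent_space S p"
  using span_tangent_onb span_base by blast

lemma surf_grad_tangent: "p \<in> topspace (surf S) \<Longrightarrow> surf_grad S u p \<in> tangent_space S p"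
  unfolding surf_grad_def span_tangent_onb[symmetric]
  by (intro span_sum span_scale span_base)

lemma surf_grad_inner:
  assumes p: "p \<in> topspace (surf S)" and u: "smooth_fun S u" and v: "v \<in> tangent_space S p"
  shows "surf_grad S u p \<bullet> v = dir_deriv S v u p"
proof -
  have "dir_deriv S v u p = dir_deriv S (\<Sum>e\<in>tangent_onb S p. (v \<bullet> e) *\<^sub>R e) u p"
    by (simp only: tangent_onb_expand[OF p v])
  also have "\<dots> = (\<Sum>e\<in>tangent_onb S p. (v \<bullet> e) *\<^sub>R dir_deriv S e u p)"
    by (rule linear_dir_deriv[OF p u finite_tangent_onb[OF p] tangent_onb_tangent[OF p]])
  also have "\<dots> = surf_grad S u p \<bullet> v"
    by (simp add: surf_grad_def inner_sum_left inner_commute[of v] mult.commute)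
  finally show ?thesis by simp
qed

text \<open>\<open>tangent_onb\<close> is chosen separately at each point and need not vary
  continuously. Characterizing the gradient by its inner products removes the choice, so that it can
  be identified with an explicit expression in a chart.\<close>

lemma surf_grad_unique:
  assumes p: "p \<in> topspace (surf S)" and u: "smooth_fun S u"
    and g: "g \<in> tangent_space S p" "\<And>v. v \<in> tangent_space S p \<Longrightarrow> g \<bullet> v = dir_deriv S v u p"
  shows "surf_grad S u p = g"
proof -
  have "surf_grad S u p - g \<in> tangent_space S p"
    using surf_grad_tangent[OF p] g(1) subspace_tangent_space[OF p] by (simp add: subspace_diff)
  then have "(surf_grad S u p - g) \<bullet> (surf_grad S u p - g) = 0"
    using surf_grad_inner[OF p u] g(2) by (simp add: inner_diff_left)
  then show ?thesis by simp
qed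

text \<open>In a chart the gradient is \<open>dX(w)\<close>, where \<open>X\<close> is the position vector and \<open>w\<close> solves the linear system
  given by the Gram matrix; Cramer's rule exhibits its continuous dependence on the point.\<close>

lemma continuous_map_surf_grad:
  assumes u: "smooth_fun S u"
  shows "continuous_map (surf S) euclidean (surf_grad S u)"
proof (rule continuous_map_chartsI)
  fix V \<psi> assume c: "(V, \<psi>) \<in> params S"
  let ?X = "\<lambda>y. D V (pos S \<circ> \<psi>) y"
  let ?U = "\<lambda>y. D V (u \<circ> \<psi>) y"
  define b where "b y = (\<chi> i. ?U y (axis i 1))" for y
  define w where "w y = (\<chi> k. det (\<chi> i j. if j = k then b y $ i else gram (?X y) $ i $ j) / det (gram (?X y)))" for y
  have b_inner: "b y \<bullet> \<xi> = ?U y \<xi>" if y: "y \<in> V" for y \<xi>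
  proof -
    have "?U y \<xi> = (\<Sum>b\<in>Basis. (\<xi> \<bullet> b) *\<^sub>R ?U y b)"
      by (rule linear_Basis_expansion[OF linear_D[OF c smooth_funD[OF c u] y]])
    also have "\<dots> = (\<Sum>i\<in>UNIV. (\<xi> $ i) *\<^sub>R ?U y (axis i 1))"
      by (simp add: Basis_vec_def UNION_singleton_eq_range sum.reindex inj_on_def axis_eq_axis inner_axis)
    finally show ?thesis by (simp add: b_def inner_vec_def mult.commute)
  qed
  have grad: "surf_grad S u (\<psi> y) = ?X y (w y)" if y: "y \<in> V" for y
  proof (rule surf_grad_unique[OF chart_topspace[OF c y] u])
    have lin: "linear (?X y)" using linear_D[OF c pos_smooth[OF c] y] .
    have sol: "gram (?X y) *v w y = b y"
      using cramer[OF det_gram_nonzero[OF lin inj_D_pos[OF c y]]] unfolding w_def by blast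
    show "?X y (w y) \<in> tangent_space S (\<psi> y)" unfolding tangent_space_chart[OF c y] by blast
    fix v assume "v \<in> tangent_space S (\<psi> y)"
    then obtain \<xi> where v: "v = ?X y \<xi>" unfolding tangent_space_chart[OF c y] by blast
    show "?X y (w y) \<bullet> v = dir_deriv S v u (\<psi> y)"
      unfolding v dir_deriv_chart[OF c y u] gram_mult_vector_inner[OF lin, symmetric] sol
      by (rule b_inner[OF y])
  qed
  have b_cont: "continuous_on V (\<lambda>y. b y $ i)" for i
    unfolding b_def vec_lambda_beta by (rule chart_continuous_derivative[OF c smooth_funD[OF c u]])
  have X_cont: "continuous_on V (\<lambda>y. ?X y v)" for v
    by (rule chart_continuous_derivative[OF c pos_smooth[OF c]])
  have gram_cont: "continuous_on V (\<lambda>y. gram (?X y) $ i $ j)" for i j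
    unfolding gram_def vec_lambda_beta by (intro continuous_intros X_cont)
  have w_cont: "continuous_on V (\<lambda>y. w y $ k)" for k
    unfolding w_def vec_lambda_beta
  proof (intro continuous_on_divide)
    show "continuous_on V (\<lambda>y. det (gram (?X y)))"
      using continuous_on_gram_det[OF c] by (simp add: gram_det_eq[OF c])
    show "continuous_on V (\<lambda>y. det (\<chi> i j. if j = k then b y $ i else gram (?X y) $ i $ j))"
      unfolding det_def vec_lambda_beta
    proof (intro continuous_intros)
      show "continuous_on V (\<lambda>y. if p i = k then b y $ i else gram (?X y) $ i $ p i)" for p i
        by (cases "p i = k") (simp_all add: b_cont gram_cont)
    qed
    show "\<forall>y\<in>V. det (gram (?X y)) \<noteq> 0"
      using det_gram_nonzero[OF linear_D[OF c pos_smooth[OF c]] inj_D_pos[OF c]] by blast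
  qed
  have "?X y (w y) = (\<Sum>k\<in>UNIV. (w y $ k) *\<^sub>R ?X y (axis k 1))" if y: "y \<in> V" for y
  proof -
    have "?X y (w y) = (\<Sum>b\<in>Basis. (w y \<bullet> b) *\<^sub>R ?X y b)"
      by (rule linear_Basis_expansion[OF linear_D[OF c pos_smooth[OF c] y]])
    then show ?thesis
      by (simp add: Basis_vec_def UNION_singleton_eq_range sum.reindex inj_on_def axis_eq_axis inner_axis)
  qed
  moreover have "continuous_on V (\<lambda>y. \<Sum>k\<in>UNIV. (w y $ k) *\<^sub>R ?X y (axis k 1))"
    by (intro continuous_intros w_cont X_cont)
  ultimately show "continuous_on V (\<lambda>y. surf_grad S u (\<psi> y))"
    using grad by (simp cong: continuous_on_cong)
qed

lemma dir_deriv_compose_pos: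
  fixes F :: "real ^ ('n + 1) \<Rightarrow> real"
  assumes F: "\<And>k. Ck_on k UNIV F" and p: "p \<in> topspace (surf S)" and v: "v \<in> tangent_space S p"
  shows "dir_deriv S v (\<lambda>p. F (pos S p)) p = frechet_derivative F (at (pos S p)) v"
    and "smooth_fun S (\<lambda>p. F (pos S p))"
proof -
  show sm: "smooth_fun S (\<lambda>p. F (pos S p))"
    unfolding smooth_fun_def
  proof safe
    fix V \<psi> assume c: "(V, \<psi>) \<in> params S"
    show "smooth_on V ((\<lambda>p. F (pos S p)) \<circ> \<psi>)"
      using smooth_on_compose[OF pos_smooth[OF c] F] by (simp add: o_def)
  qed
  obtain V \<psi> y where c: "(V, \<psi>) \<in> params S" "y \<in> V" "p = \<psi> y" using chart_at[OF p] .
  obtain w where w: "v = D V (pos S \<circ> \<psi>) y w" using v unfolding c(3) tangent_space_chart[OF c(1,2)] by blast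
  have F': "(F has_derivative frechet_derivative F (at x)) (at x)" for x
    using Ck_on_derivative[OF F] by auto
  have "((\<lambda>y. F ((pos S \<circ> \<psi>) y)) has_derivative
      (\<lambda>h. frechet_derivative F (at ((pos S \<circ> \<psi>) y)) (D V (pos S \<circ> \<psi>) y h))) (at y within V)"
    by (rule has_derivative_compose[OF chart_smooth_has_derivative[OF c(1) pos_smooth[OF c(1)] c(2)] F'])
  moreover obtain k where "openin (top_of_set {y. 0 \<le> y $ k}) V" using chart_half_space[OF c(1)] by blast
  ultimately have "D V ((\<lambda>p. F (pos S p)) \<circ> \<psi>) y = (\<lambda>h. frechet_derivative F (at (pos S p)) (D V (pos S \<circ> \<psi>) y h))"
    using half_space_derivative_unique[of k V y] c by (simp add: o_def)
  then show "dir_deriv S v (\<lambda>p. F (pos S p)) p = frechet_derivative F (at (pos S p)) v"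
    unfolding w c(3) dir_deriv_chart[OF c(1,2) sm] by simp
qed

text \<open>The derivative in the direction of the gradient is its squared norm, so the bound is
  applied to this one direction.\<close>

lemma norm_surf_grad_le:
  assumes p: "p \<in> topspace (surf S)" and u: "smooth_fun S u"
    and bound: "\<And>v. v \<in> tangent_space S p \<Longrightarrow> \<bar>dir_deriv S v u p\<bar> \<le> c * norm v" and "c \<ge> 0"
  shows "norm (surf_grad S u p) \<le> c"
proof (cases "surf_grad S u p = 0")
  case False
  have "norm (surf_grad S u p) * norm (surf_grad S u p) = surf_grad S u p \<bullet> surf_grad S u p"
    by (simp add: dot_square_norm power2_eq_square)
  also have "\<dots> = dir_deriv S (surf_grad S u p) u p"
    by (rule surf_grad_inner[OF p u surf_grad_tangent[OF p]])
  also have "\<dots> \<le> c * norm (surf_grad S u p)"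
    using bound[OF surf_grad_tangent[OF p]] abs_le_D1 by blast
  finally show ?thesis using False by simp
qed (use \<open>c \<ge> 0\<close> in simp)

end

section \<open>The unit normal and the second fundamental form\<close>

locale two_sided_surface = immersed_surface S for S :: "('m, 'n::finite) hypersurface" +
  assumes two_sided: "two_sided S"
begin

lemma nrm_smooth_fun: "smooth_fun S (nrm S)"
  using two_sided by (simp add: two_sided_def)

lemma norm_nrm: "p \<in> topspace (surf S) \<Longrightarrow> norm (nrm S p) = 1"
  using two_sided by (simp add: two_sided_def)

text \<open>Two-sidedness gives one inclusion; both spaces have dimension n because the derivative
  of the position is injective and the normal is nonzero.\<close>

lemma tangent_space_eq_orthogonal:
  assumes p: "p \<in> topspace (surf S)"
  shows "tangent_space S p = {v. nrm S p \<bullet> v = 0}"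
proof (rule subspace_dim_equal[OF subspace_tangent_space[OF p] subspace_hyperplane])
  obtain V \<psi> y where c: "(V, \<psi>) \<in> params S" "y \<in> V" "p = \<psi> y" using chart_at[OF p] .
  show "tangent_space S p \<subseteq> {v. nrm S p \<bullet> v = 0}"
    unfolding c(3) tangent_space_chart[OF c(1,2)] using two_sided c unfolding two_sided_def by blast
  have "nrm S p \<noteq> 0" using norm_nrm[OF p] by auto
  then have "dim {v. nrm S p \<bullet> v = 0} = CARD('n)"
    by (simp add: dim_hyperplane)
  moreover have "dim (tangent_space S p) = CARD('n)"
    unfolding c(3) tangent_space_chart[OF c(1,2)]
    using dim_image_eq[OF linear_D[OF c(1) pos_smooth[OF c(1)] c(2)], of UNIV] inj_D_pos[OF c(1,2)]
    by simp
  ultimately show "dim {v. nrm S p \<bullet> v = 0} \<le> dim (tangent_space S p)" by simp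
qed

lemma nrm_component_smooth: "smooth_fun S (\<lambda>p. nrm S p $ k)"
  unfolding smooth_fun_def
proof safe
  fix V \<psi> assume c: "(V, \<psi>) \<in> params S"
  have "Ck_on j UNIV (\<lambda>x :: real ^ ('n + 1). x $ k)" for j
    by (rule Ck_on_bounded_linear[OF bounded_linear_vec_nth]) simp
  from smooth_on_compose[OF smooth_funD[OF c nrm_smooth_fun] this]
  show "smooth_on V ((\<lambda>p. nrm S p $ k) \<circ> \<psi>)" by (simp add: o_def)
qed

text \<open>Differentiating |N|^2 = 1 shows that derivatives of the normal are orthogonal to it,
  hence tangential.\<close>

lemma dir_deriv_nrm:
  assumes p: "p \<in> topspace (surf S)" and v: "v \<in> tangent_space S p"
  shows dir_deriv_nrm_component: "dir_deriv S v (\<lambda>p. nrm S p $ k) p = dir_deriv S v (nrm S) p $ k"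
    and dir_deriv_nrm_tangent: "dir_deriv S v (nrm S) p \<in> tangent_space S p"
proof -
  obtain V \<psi> y where c: "(V, \<psi>) \<in> params S" "y \<in> V" "p = \<psi> y" using chart_at[OF p] .
  obtain w where w: "v = D V (pos S \<circ> \<psi>) y w" using v unfolding c(3) tangent_space_chart[OF c(1,2)] by blast
  obtain j where V: "openin (top_of_set {y. 0 \<le> y $ j}) V" using chart_half_space[OF c(1)] by blast
  have N': "(nrm S \<circ> \<psi> has_derivative D V (nrm S \<circ> \<psi>) y) (at y within V)"
    by (rule chart_smooth_has_derivative[OF c(1) smooth_funD[OF c(1) nrm_smooth_fun] c(2)])
  have "D V ((\<lambda>p. nrm S p $ k) \<circ> \<psi>) y = (\<lambda>h. D V (nrm S \<circ> \<psi>) y h $ k)"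
    using half_space_derivative_unique[OF V c(2) bounded_linear.has_derivative[OF bounded_linear_vec_nth N']]
    by (simp add: o_def)
  then show "dir_deriv S v (\<lambda>p. nrm S p $ k) p = dir_deriv S v (nrm S) p $ k"
    unfolding w c(3) dir_deriv_chart[OF c(1,2) nrm_component_smooth] dir_deriv_chart[OF c(1,2) nrm_smooth_fun]
    by simp
  have N2: "((\<lambda>y. (nrm S \<circ> \<psi>) y \<bullet> (nrm S \<circ> \<psi>) y) has_derivative
      (\<lambda>h. (nrm S \<circ> \<psi>) y \<bullet> D V (nrm S \<circ> \<psi>) y h + D V (nrm S \<circ> \<psi>) y h \<bullet> (nrm S \<circ> \<psi>) y)) (at y within V)"
    by (rule has_derivative_inner[OF N' N'])
  have one: "(nrm S \<circ> \<psi>) z \<bullet> (nrm S \<circ> \<psi>) z = 1" if "z \<in> V" for z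
    using norm_nrm[OF chart_topspace[OF c(1) that]] by (simp add: dot_square_norm)
  have "((\<lambda>y. 1 :: real) has_derivative
      (\<lambda>h. (nrm S \<circ> \<psi>) y \<bullet> D V (nrm S \<circ> \<psi>) y h + D V (nrm S \<circ> \<psi>) y h \<bullet> (nrm S \<circ> \<psi>) y)) (at y within V)"
    by (rule has_derivative_transform[OF c(2) _ N2]) (simp only: one)
  from half_space_derivative_unique[OF V c(2) this] half_space_derivative_unique[OF V c(2) has_derivative_const[of "1 :: real"]]
  have "nrm S p \<bullet> D V (nrm S \<circ> \<psi>) y w = 0"
    using c(3) by (simp add: fun_eq_iff inner_commute)
  then show "dir_deriv S v (nrm S) p \<in> tangent_space S p"
    unfolding tangent_space_eq_orthogonal[OF p] unfolding w c(3) dir_deriv_chart[OF c(1,2) nrm_smooth_fun] by simp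
qed

text \<open>Derivatives of N are tangential, so summing over the second basis vector gives |dN(e)|^2
  by Parseval; splitting this into components of N and exchanging sums yields gradients. Written
  this way |A|^2 no longer involves the chosen basis explicitly, and its continuity reduces to that
  of gradients.\<close>

lemma norm_A_eq:
  assumes p: "p \<in> topspace (surf S)"
  shows "(norm_A S p)\<^sup>2 = (\<Sum>k\<in>UNIV. (norm (surf_grad S (\<lambda>p. nrm S p $ k) p))\<^sup>2)"
proof -
  let ?E = "tangent_onb S p"
  let ?N = "\<lambda>e. dir_deriv S e (nrm S) p"
  have "(norm_A S p)\<^sup>2 = (\<Sum>e\<in>?E. \<Sum>e'\<in>?E. (?N e \<bullet> e')\<^sup>2)"
    by (simp add: norm_A_def second_ff_def sum_nonneg)
  also have "\<dots> = (\<Sum>e\<in>?E. (norm (?N e))\<^sup>2)"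
  proof (rule sum.cong[OF refl])
    fix e assume "e \<in> ?E"
    then have "?N e \<in> tangent_space S p"
      using dir_deriv_nrm_tangent[OF p] tangent_onb_tangent[OF p] by blast
    from tangent_onb_expand[OF p this] norm_sum_tangent_onb[OF p, of "\<lambda>e'. ?N e \<bullet> e'"]
    show "(\<Sum>e'\<in>?E. (?N e \<bullet> e')\<^sup>2) = (norm (?N e))\<^sup>2" by simp
  qed
  also have "\<dots> = (\<Sum>e\<in>?E. \<Sum>k\<in>UNIV. (?N e $ k)\<^sup>2)"
    by (simp only: power2_norm_eq_inner) (simp add: inner_vec_def power2_eq_square)
  also have "\<dots> = (\<Sum>k\<in>UNIV. \<Sum>e\<in>?E. (?N e $ k)\<^sup>2)"
    by (rule sum.swap)
  also have "\<dots> = (\<Sum>k\<in>UNIV. (norm (surf_grad S (\<lambda>p. nrm S p $ k) p))\<^sup>2)"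
    unfolding surf_grad_def norm_sum_tangent_onb[OF p]
    by (intro sum.cong refl) (simp add: dir_deriv_nrm_component[OF p tangent_onb_tangent[OF p]])
  finally show ?thesis .
qed

lemma continuous_map_norm_A: "continuous_map (surf S) euclideanreal (\<lambda>p. (norm_A S p)\<^sup>2)"
proof (rule continuous_map_eq)
  show "continuous_map (surf S) euclideanreal (\<lambda>p. \<Sum>k\<in>UNIV. (norm (surf_grad S (\<lambda>p. nrm S p $ k) p))\<^sup>2)"
    by (intro continuous_map_sum continuous_map_real_pow continuous_map_norm continuous_map_surf_grad
        nrm_component_smooth) auto
qed (simp add: norm_A_eq)

end

section \<open>The curvature estimate\<close>

text \<open>Along the segment from the identity to the Gram matrix the matrices are positive
  definite before the endpoint, and the endpoint is nonsingular. The determinant starts at 1 and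
  cannot change sign without a zero.\<close>

lemma det_gram_pos:
  assumes L: "linear L" "inj L"
  shows "det (gram L) > 0"
proof (rule ccontr)
  assume "\<not> det (gram L) > 0"
  define H where "H t = (1 - t) *\<^sub>R mat 1 + t *\<^sub>R gram L" for t :: real
  have nz: "det (H t) \<noteq> 0" if t: "0 \<le> t" "t < 1" for t
  proof -
    have "w = 0" if w: "H t *v w = 0" for w
    proof -
      have "H t *v w = (1 - t) *\<^sub>R w + t *\<^sub>R (gram L *v w)"
        by (simp add: H_def matrix_vector_mult_add_rdistrib scaleR_matrix_vector_assoc[symmetric])
      then have "0 = ((1 - t) *\<^sub>R w + t *\<^sub>R (gram L *v w)) \<bullet> w" using w by simp
      also have "\<dots> = (1 - t) * (w \<bullet> w) + t * (L w \<bullet> L w)"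
        by (simp add: inner_add_left gram_mult_vector_inner[OF L(1)])
      finally have "(1 - t) * (w \<bullet> w) \<le> 0" using t by (smt (verit) inner_ge_zero mult_nonneg_nonneg)
      then have "w \<bullet> w \<le> 0" using t by (simp add: mult_le_0_iff)
      then show ?thesis by (meson antisym inner_ge_zero inner_eq_zero_iff)
    qed
    then have "inj ((*v) (H t))" by (simp add: linear_injective_0)
    then show ?thesis by (metis det_nz_iff_inj matrix_of_matrix_vector_mul matrix_vector_mul_linear)
  qed
  have "continuous_on {0..1} (\<lambda>t. det (H t))"
    unfolding det_def H_def by (intro continuous_intros)
  moreover have "det (H 1) < 0" "det (H 0) = 1"
    using \<open>\<not> det (gram L) > 0\<close> det_gram_nonzero[OF L] by (auto simp: H_def)
  ultimately obtain t where "0 \<le> t" "t \<le> 1" "det (H t) = 0"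
    using IVT2'[of "\<lambda>t. det (H t)" 1 0 0] by auto
  then show False using nz[of t] \<open>det (H 1) < 0\<close> by (cases "t = 1") auto
qed

lemma has_derivative_lipschitz_bound:
  fixes F :: "'a::real_normed_vector \<Rightarrow> real"
  assumes F: "(F has_derivative F') (at x)" and c: "\<And>y. \<bar>F y - F x\<bar> \<le> c * norm (y - x)"
  shows "\<bar>F' v\<bar> \<le> c * norm v"
proof -
  have "((\<lambda>t. x + t *\<^sub>R v) has_derivative (\<lambda>t. t *\<^sub>R v)) (at 0)"
    by (auto intro!: derivative_eq_intros)
  then have "((\<lambda>t. F (x + t *\<^sub>R v)) has_derivative (\<lambda>t. F' (t *\<^sub>R v))) (at 0)"
    by (rule has_derivative_compose) (use F in simp)
  moreover have "(\<lambda>t. F' (t *\<^sub>R v)) = (*) (F' v)"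
    using linear_scale[OF has_derivative_linear[OF F]] by (simp add: fun_eq_iff mult.commute)
  ultimately have "((\<lambda>t. F (x + t *\<^sub>R v)) has_real_derivative F' v) (at 0)"
    by (simp only: has_field_derivative_def)
  then have "((\<lambda>h. (F (x + h *\<^sub>R v) - F x) / h) \<longlongrightarrow> F' v) (at 0)"
    by (simp add: DERIV_def)
  then have lim: "((\<lambda>h. \<bar>(F (x + h *\<^sub>R v) - F x) / h\<bar>) \<longlongrightarrow> \<bar>F' v\<bar>) (at 0)"
    by (rule tendsto_rabs)
  have "\<bar>(F (x + h *\<^sub>R v) - F x) / h\<bar> \<le> c * norm v" if "h \<noteq> 0" for h
    using c[of "x + h *\<^sub>R v"] that by (simp add: abs_divide divide_le_eq mult.assoc mult.commute[of "norm v"])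
  then have "\<forall>\<^sub>F h in at 0. \<bar>(F (x + h *\<^sub>R v) - F x) / h\<bar> \<le> c * norm v"
    by (auto simp: eventually_at_filter)
  with lim show ?thesis
    by (rule tendsto_upperbound) simp
qed

section \<open>Null open sets and a bump function in a chart\<close>

context immersed_surface
begin

text \<open>In a chart a nonempty open set contains a Euclidean ball, on which the density is
  positive. This turns vanishing almost everywhere into vanishing everywhere for continuous
  functions.\<close>

lemma null_open_empty:
  assumes Z: "openin (surf S) Z" and null: "emeasure (area S) Z = 0"
  shows "Z = {}"
proof (rule ccontr)
  assume "Z \<noteq> {}"
  then obtain p where p: "p \<in> Z" "p \<in> topspace (surf S)" using openin_subset[OF Z] by blast
  obtain V \<psi> y where c: "(V, \<psi>) \<in> params S" "y \<in> V" "p = \<psi> y" using chart_at[OF p(2)] .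
  define Y where "Y = Z \<inter> \<psi> ` V"
  have Y: "openin (surf S) Y" unfolding Y_def using Z chart_open[OF c(1)] by (rule openin_Int)
  have "emeasure (area S) Y \<le> emeasure (area S) Z"
    using openin_borel_surf[OF Z] by (intro emeasure_mono) (auto simp: Y_def sets_area)
  then have "chart_area V \<psi> Y = 0"
    using null emeasure_area_chart[OF c(1) openin_borel_surf[OF Y]] by (simp add: Y_def)
  moreover define A where "A = V \<inter> \<psi> -` Y"
  have A: "A \<in> sets borel" unfolding A_def by (rule chart_preimage_borel[OF c(1) openin_borel_surf[OF Y]])
  ultimately have "AE z in lborel. ennreal (sqrt (gram_det S V \<psi> z)) * indicator A z = 0"
    unfolding chart_area_def using gram_det_measurable[OF c(1) A]
    by (subst (asm) nn_integral_0_iff_AE) (auto simp: A_def)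
  moreover have "gram_det S V \<psi> z > 0" if "z \<in> V" for z
    unfolding gram_det_eq[OF c(1)]
    using det_gram_pos[OF linear_D[OF c(1) pos_smooth[OF c(1)] that] inj_D_pos[OF c(1) that]] .
  then have "ennreal (sqrt (gram_det S V \<psi> z)) \<noteq> 0" if "z \<in> V" for z
    using that by (simp add: ennreal_eq_0_iff not_le)
  ultimately have ae: "AE z in lborel. z \<notin> A"
    by (elim eventually_mono) (auto simp: A_def indicator_def split: if_splits)
  obtain k where k: "openin (top_of_set {y. 0 \<le> y $ k}) V" using chart_half_space[OF c(1)] by blast
  have "openin (top_of_set {y. 0 \<le> y $ k}) A"
    unfolding A_def using openin_trans[OF chart_preimage_openin[OF c(1) Y] k] .
  moreover have "y \<in> A" using c p by (auto simp: A_def Y_def)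
  ultimately obtain r where r: "r > 0" "ball y r \<inter> {y. 0 \<le> y $ k} \<subseteq> A"
    unfolding openin_contains_ball by blast
  define G where "G = ball y r \<inter> {y. 0 < y $ k}"
  have G: "open G" unfolding G_def by (intro open_Int open_ball open_Collect_less continuous_intros)
  have "y $ k \<ge> 0" using openin_imp_subset[OF k] c(2) by auto
  \<comment> \<open>The point \<open>y\<close> may lie on the boundary of the half-space; moving
    inward by half the radius reaches a point with a full Euclidean ball inside
    \<open>A\<close>.\<close>
  then have "y + (r / 2) *\<^sub>R axis k 1 \<in> G" using r by (auto simp: G_def dist_norm)
  then obtain z s where s: "s > 0" "ball z s \<subseteq> G" using G openE by blast
  then have "AE x in lborel. x \<notin> ball z s"
    using ae r(2) by (elim eventually_mono) (force simp: G_def)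
  then have "ball z s \<in> null_sets lborel" by (simp add: AE_iff_null_sets)
  then have "measure lborel (ball z s) = 0" by (simp add: measure_def null_sets_def)
  then show False using content_ball_pos[OF s(1), of z] by simp
qed

end

context immersed_surface
begin

text \<open>A bump function in a chart, extended by zero; its gradient cannot vanish identically.\<close>

lemma nonconstant_test_fun:
  obtains \<phi> where "test_fun S \<phi>" "\<And>p. \<phi> p \<ge> 0" "\<exists>p\<in>topspace (surf S). \<phi> p \<noteq> 0"
    "\<exists>p\<in>topspace (surf S). surf_grad S \<phi> p \<noteq> 0"
proof -
  obtain p where "p \<in> topspace (surf S)" using nonempty by blast
  then obtain V \<psi> y where c: "(V, \<psi>) \<in> params S" "y \<in> V" using chart_at by metis
  obtain k where k: "openin (top_of_set {y. 0 \<le> y $ k}) V" using chart_half_space[OF c(1)] by blast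
  obtain s where s: "s > 0" "ball y s \<inter> {y. 0 \<le> y $ k} \<subseteq> V"
    using k c(2) unfolding openin_contains_ball by blast
  define G where "G = ball y s \<inter> {y. 0 < y $ k}"
  have G: "open G" unfolding G_def by (intro open_Int open_ball open_Collect_less continuous_intros)
  have "y $ k \<ge> 0" using openin_imp_subset[OF k] c(2) by auto
  then have "y + (s / 2) *\<^sub>R axis k 1 \<in> G" using s by (auto simp: G_def dist_norm)
  then obtain z0 r where r: "r > 0" "cball z0 r \<subseteq> G" using G open_contains_cball by blast
  have "G \<subseteq> V" using s by (force simp: G_def)
  then have rV: "cball z0 r \<subseteq> interior V" "cball z0 r \<subseteq> V"
    using r G by (auto intro: interiorI)
  define \<beta> where "\<beta> z = flat_exp 0 (r\<^sup>2 - (norm (z - z0))\<^sup>2)" for z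
  have \<beta>_Ck: "Ck_on j UNIV \<beta>" for j
  proof -
    have "Ck_on j UNIV (\<lambda>z. r\<^sup>2 + (- 1) *\<^sub>R (norm (z - z0))\<^sup>2)"
      by (intro Ck_on_add Ck_on_scaleR Ck_on_const Ck_on_norm_squared) auto
    then show ?thesis
      unfolding \<beta>_def[abs_def]
      using Ck_on_compose[of j UNIV "flat_exp 0" UNIV "\<lambda>z. r\<^sup>2 - (norm (z - z0))\<^sup>2", OF Ck_on_flat_exp] by simp
  qed
  have \<beta>0: "\<beta> z = 0" if "norm (z - z0) \<ge> r" for z
  proof -
    have "r\<^sup>2 \<le> (norm (z - z0))\<^sup>2" using that r(1) by (intro power_mono) auto
    then show ?thesis by (simp add: \<beta>_def flat_exp_def)
  qed
  have \<beta>_pos: "\<beta> z0 > 0" using r by (simp add: \<beta>_def flat_exp_def)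
  define \<phi> where "\<phi> p = (if p \<in> \<psi> ` V then \<beta> (the_inv_into V \<psi> p) else 0)" for p
  have \<phi>: "\<phi> (\<psi> z) = \<beta> z" if "z \<in> V" for z
    using that by (simp add: \<phi>_def the_inv_into_f_f[OF chart_inj[OF c(1)]])
  define K where "K = \<psi> ` cball z0 r"
  have K: "compactin (surf S) K"
    unfolding K_def using rV(2)
    by (intro image_compactin[OF _ chart_continuous[OF c(1)]]) (simp add: compactin_subtopology)
  \<comment> \<open>In a Hausdorff space the compact set \<open>K\<close> is closed. Its complement
    is then open, which is what makes the extension by zero smooth across the edge of the
    chart.\<close>
  then have K_closed: "closedin (surf S) K"
    using manifold unfolding smooth_manifold_def by (intro compactin_imp_closedin) auto
  have \<phi>_outside: "\<phi> p = 0" if "p \<notin> K" for p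
  proof (cases "p \<in> \<psi> ` V")
    case True
    then obtain z where z: "z \<in> V" "p = \<psi> z" by blast
    then have "z \<notin> cball z0 r" using that by (auto simp: K_def)
    then have "norm (z - z0) \<ge> r" by (simp add: dist_norm norm_minus_commute)
    then show ?thesis using \<beta>0 \<phi> z by simp
  qed (simp add: \<phi>_def)
  have smooth: "smooth_fun S \<phi>"
    unfolding smooth_fun_def
  proof safe
    fix W \<theta> assume W: "(W, \<theta>) \<in> params S"
    show "smooth_on W (\<phi> \<circ> \<theta>)"
      unfolding smooth_on_def
    proof
      fix a assume a: "a \<in> W"
      show "\<exists>U g. open U \<and> a \<in> U \<and> (\<forall>k. Ck_on k U g) \<and> (\<forall>x\<in>W \<inter> U. g x = (\<phi> \<circ> \<theta>) x)"
      \<comment> \<open>Where the two charts overlap, the function is \<beta> after the coordinate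
        change. A point outside the image of the first chart lies off \<open>K\<close> and has a
        neighbourhood on which the function vanishes.\<close>
      proof (cases "\<theta> a \<in> \<psi> ` V")
        case True
        define A where "A = transition_domain W \<theta> V \<psi>"
        have aA: "a \<in> A" using a True by (simp add: A_def transition_domain_def[OF W c(1)])
        have "smooth_on A (\<lambda>x. \<beta> (transition \<theta> V \<psi> x))"
          unfolding A_def by (rule smooth_on_compose[OF transition_smooth[OF W c(1)] \<beta>_Ck])
        then obtain U g where U: "open U" "a \<in> U" "\<forall>k. Ck_on k U g"
            "\<forall>x\<in>A \<inter> U. g x = \<beta> (transition \<theta> V \<psi> x)"
          using aA unfolding smooth_on_def by blast
        obtain T where T: "open T" "A = W \<inter> T"
          using transition_domain_openin[OF W c(1)] unfolding A_def openin_open by blast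
        have "g x = (\<phi> \<circ> \<theta>) x" if x: "x \<in> W \<inter> (U \<inter> T)" for x
        proof -
          have xA: "x \<in> A" using x T by blast
          then have "\<theta> x \<in> \<psi> ` V" by (simp add: A_def transition_domain_def[OF W c(1)])
          then have "\<phi> (\<theta> x) = \<beta> (transition \<theta> V \<psi> x)"
            by (simp add: \<phi>_def transition_def[OF W c(1)])
          then show ?thesis using U(4) x xA by simp
        qed
        moreover have "Ck_on k (U \<inter> T) g" for k using U(3) Ck_on_subset[of k U g "U \<inter> T"] by blast
        moreover have "a \<in> U \<inter> T" "open (U \<inter> T)" using U T aA by auto
        ultimately show ?thesis by blast
      next
        case False
        have "openin (surf S) (topspace (surf S) - K)" using K_closed by blast
        from chart_preimage_openin[OF W this]
        obtain T where T: "open T" "W \<inter> \<theta> -` (topspace (surf S) - K) = W \<inter> T"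
          unfolding openin_open by blast
        have "\<theta> a \<notin> K" using False rV(2) by (auto simp: K_def)
        then have "a \<in> T" using a T(2) chart_topspace[OF W a] by blast
        moreover have "0 = (\<phi> \<circ> \<theta>) x" if "x \<in> W \<inter> T" for x
        proof -
          have "\<theta> x \<notin> K" using that T(2) by blast
          then show ?thesis using \<phi>_outside by simp
        qed
        moreover have "Ck_on k T (\<lambda>x. 0 :: real)" for k using Ck_on_const[OF T(1)] .
        ultimately show ?thesis using T(1) by (intro exI[of _ T] exI[of _ "\<lambda>x. 0 :: real"]) auto
      qed
    qed
  qed
  have cl: "surf S closure_of {p \<in> topspace (surf S). \<phi> p \<noteq> 0} \<subseteq> K"
    using \<phi>_outside by (intro closure_of_minimal[OF _ K_closed]) blast
  have "test_fun S \<phi>"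
    unfolding test_fun_def
  proof (intro conjI smooth)
    show "compactin (surf S) (surf S closure_of {p \<in> topspace (surf S). \<phi> p \<noteq> 0})"
      using closed_compactin[OF K cl] by simp
    have "K \<subseteq> surf_interior S" using c(1) rV(1) unfolding K_def surf_interior_def by blast
    then show "surf S closure_of {p \<in> topspace (surf S). \<phi> p \<noteq> 0} \<subseteq> surf_interior S"
      using cl by blast
  qed
  moreover have "\<phi> p \<ge> 0" for p by (simp add: \<phi>_def \<beta>_def flat_exp_nonneg)
  moreover have z0V: "z0 \<in> V" using rV(2) r by auto
  then have "\<exists>p\<in>topspace (surf S). \<phi> p \<noteq> 0"
    using \<phi>[OF z0V] \<beta>_pos chart_topspace[OF c(1) z0V] by (intro bexI[of _ "\<psi> z0"]) auto
  moreover have "\<exists>p\<in>topspace (surf S). surf_grad S \<phi> p \<noteq> 0"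
  proof (rule ccontr)
    assume "\<not> (\<exists>p\<in>topspace (surf S). surf_grad S \<phi> p \<noteq> 0)"
    then have g0: "surf_grad S \<phi> (\<psi> z) = 0" if "z \<in> V" for z
      using chart_topspace[OF c(1) that] by blast
    \<comment> \<open>Zero gradient makes the bump constant on the ball, although it is positive at
      the centre and zero on the bounding sphere.\<close>
    have "(\<phi> \<circ> \<psi> has_derivative (\<lambda>h. 0)) (at z within cball z0 r)" if z: "z \<in> cball z0 r" for z
    proof -
      have zV: "z \<in> V" using z rV by blast
      have "D V (\<phi> \<circ> \<psi>) z h = 0" for h
      proof -
        have "D V (\<phi> \<circ> \<psi>) z h = dir_deriv S (D V (pos S \<circ> \<psi>) z h) \<phi> (\<psi> z)"
          by (simp only: dir_deriv_chart[OF c(1) zV smooth])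
        also have "\<dots> = surf_grad S \<phi> (\<psi> z) \<bullet> D V (pos S \<circ> \<psi>) z h"
          by (rule surf_grad_inner[OF chart_topspace[OF c(1) zV] smooth, symmetric])
            (simp add: tangent_space_chart[OF c(1) zV])
        finally show ?thesis by (simp add: g0[OF zV])
      qed
      then have "D V (\<phi> \<circ> \<psi>) z = (\<lambda>h. 0)" by blast
      then have "(\<phi> \<circ> \<psi> has_derivative (\<lambda>h. 0)) (at z within V)"
        using chart_smooth_has_derivative[OF c(1) smooth_funD[OF c(1) smooth] zV] by simp
      then show ?thesis using rV(2) by (rule has_derivative_subset)
    qed
    then obtain C where C: "\<And>z. z \<in> cball z0 r \<Longrightarrow> (\<phi> \<circ> \<psi>) z = C"
      using has_derivative_zero_constant[of "cball z0 r" "\<phi> \<circ> \<psi>"] by auto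
    obtain e :: "real ^ 'n" where e: "norm e = 1" using vector_choose_size[of 1] by auto
    have z1: "z0 + r *\<^sub>R e \<in> cball z0 r" using r e by (simp add: dist_norm)
    then have "(\<phi> \<circ> \<psi>) (z0 + r *\<^sub>R e) = 0"
      using \<phi>[of "z0 + r *\<^sub>R e"] \<beta>0[of "z0 + r *\<^sub>R e"] rV(2) r e by auto
    moreover have "(\<phi> \<circ> \<psi>) z0 > 0" using \<phi>[OF z0V] \<beta>_pos by simp
    ultimately show False using C[OF z1] C[of z0] r by simp
  qed
  ultimately show ?thesis using that by blast
qed

end

section \<open>Integration over a compact hypersurface and the cutoff inequality\<close>

locale compact_surface = two_sided_surface S for S :: "('m, 'n::finite) hypersurface" +
  assumes compact: "compact_space (surf S)"
begin

lemma continuous_map_borel: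
  fixes f :: "'m \<Rightarrow> 'b::topological_space"
  assumes "continuous_map (surf S) euclidean f"
  shows "f \<in> borel_measurable borel_surf"
proof (rule borel_measurableI)
  fix U :: "'b set" assume "open U"
  then have "openin (surf S) {p \<in> topspace (surf S). f p \<in> U}"
    using openin_continuous_map_preimage[OF assms] by simp
  then show "f -` U \<inter> space borel_surf \<in> sets borel_surf"
    using openin_borel_surf by (simp add: space_borel_surf vimage_def Int_def conj_commute)
qed

lemma weight_measurable: "(\<lambda>p. ennreal (exp (- (norm (pos S p))\<^sup>2 / 4))) \<in> borel_measurable (area S)"
proof -
  have "pos S \<in> borel_measurable (area S)"
    using continuous_map_borel[OF smooth_fun_continuous_map[OF pos_smooth_fun]]
    by (simp add: measurable_cong_sets[OF sets_area refl])
  then show ?thesis by measurable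
qed

lemma space_garea: "space (garea S) = topspace (surf S)"
  and sets_garea: "sets (garea S) = sets borel_surf"
  by (simp_all add: garea_def space_area sets_area)

lemma finite_measure_garea: "finite_measure (garea S)"
proof (rule finite_measureI)
  have "emeasure (garea S) (space (garea S)) =
      (\<integral>\<^sup>+p. ennreal (exp (- (norm (pos S p))\<^sup>2 / 4)) * indicator (topspace (surf S)) p \<partial>area S)"
    unfolding space_garea unfolding garea_def
    by (rule emeasure_density[OF weight_measurable]) (simp add: sets_area openin_borel_surf)
  also have "\<dots> \<le> (\<integral>\<^sup>+p. indicator (topspace (surf S)) p \<partial>area S)"
    by (intro nn_integral_mono) (auto simp: indicator_def ennreal_le_1)
  also have "\<dots> = emeasure (area S) (topspace (surf S))"
    by (simp add: sets_area openin_borel_surf)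
  also have "\<dots> < \<infinity>" by (rule finite_area[OF compact])
  finally show "emeasure (garea S) (space (garea S)) \<noteq> \<infinity>" by simp
qed

sublocale finite_measure "garea S" by (rule finite_measure_garea)

text \<open>By compactness a continuous function is bounded, and the measure is finite. This
  protects the integrals below from the default value 0.\<close>

lemma continuous_map_integrable:
  fixes f :: "'m \<Rightarrow> 'b::{banach, second_countable_topology}"
  assumes f: "continuous_map (surf S) euclidean f"
  shows "integrable (garea S) f"
proof -
  have "compactin euclidean (f ` topspace (surf S))"
    using image_compactin[OF _ f] compact by (simp add: compact_space_def)
  then have "bounded (f ` topspace (surf S))" by (simp add: compact_imp_bounded)
  then obtain C where C: "\<And>p. p \<in> topspace (surf S) \<Longrightarrow> norm (f p) \<le> C"
    unfolding bounded_iff by blast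
  show ?thesis
  proof (rule integrable_const_bound[of _ C])
    show "AE p in garea S. norm (f p) \<le> C" using C by (auto simp: space_garea intro!: AE_I2)
    show "f \<in> borel_measurable (garea S)"
      using continuous_map_borel[OF f] by (simp add: measurable_cong_sets[OF sets_garea refl])
  qed
qed

lemma part_in_sets: "A \<in> sets borel \<Longrightarrow> part_in S A \<in> sets (garea S)"
  using measurable_sets[OF continuous_map_borel[OF smooth_fun_continuous_map[OF pos_smooth_fun]]]
  by (simp add: sets_garea part_in_def space_borel_surf vimage_def Int_def conj_commute)

text \<open>The Gaussian weight is positive, so \<open>garea\<close> and \<open>area\<close> have
  the same null sets. The set where \<open>f\<close> is nonzero is open and null, hence
  empty.\<close>

lemma AE_garea_zero:
  fixes f :: "'m \<Rightarrow> 'b::real_normed_vector"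
  assumes f: "continuous_map (surf S) euclidean f" and ae: "AE p in garea S. f p = 0" and p: "p \<in> topspace (surf S)"
  shows "f p = 0"
proof -
  let ?Z = "{p \<in> topspace (surf S). f p \<in> - {0}}"
  have Z: "openin (surf S) ?Z"
    by (rule openin_continuous_map_preimage[OF f]) (simp add: open_Compl)
  have "AE p in area S. f p = 0"
    using ae unfolding garea_def AE_density[OF weight_measurable] by (auto elim: eventually_mono)
  then have "AE p in area S. p \<notin> ?Z" by (auto elim: eventually_mono)
  then have "?Z \<in> null_sets (area S)"
    using AE_iff_null_sets[of ?Z "area S"] openin_borel_surf[OF Z] by (simp add: sets_area)
  then have "?Z = {}" using null_open_empty[OF Z] by (simp add: null_sets_def)
  then show ?thesis using p by blast
qed

lemma continuous_map_surf_grad_norm: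
  "smooth_fun S u \<Longrightarrow> continuous_map (surf S) euclideanreal (\<lambda>p. (norm (surf_grad S u p))\<^sup>2)"
  by (intro continuous_map_real_pow continuous_map_norm continuous_map_surf_grad)

text \<open>\<open>S\<close> is itself admissible in \<open>stability_const\<close>. The left-hand
  side there is nonnegative, so for B < 0 every admissible test function would have a gradient that
  vanishes almost everywhere, hence everywhere by continuity.\<close>

lemma stability_const_nonneg:
  assumes B: "stability_const TYPE(('m, 'n) hypersurface) B" and "gaussian_cmc S" "gaussian_stable S"
  shows "B \<ge> 0"
proof (rule ccontr)
  assume "\<not> B \<ge> 0"
  obtain \<phi> where \<phi>: "test_fun S \<phi>" "\<And>p. \<phi> p \<ge> 0" "\<exists>p\<in>topspace (surf S). \<phi> p \<noteq> 0"
    "\<exists>p\<in>topspace (surf S). surf_grad S \<phi> p \<noteq> 0"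
    using nonconstant_test_fun by blast
  have sm: "smooth_fun S \<phi>" using \<phi>(1) by (simp add: test_fun_def)
  let ?I = "\<integral>p. (norm (surf_grad S \<phi> p))\<^sup>2 \<partial>garea S"
  have "(\<integral>p. (\<phi> p)\<^sup>2 * (norm (nrm S p - avg_normal S \<phi>))\<^sup>2 \<partial>garea S)
        + (norm (avg_normal S \<phi>))\<^sup>2 * (\<integral>p. (\<phi> p)\<^sup>2 * (norm_A S p)\<^sup>2 \<partial>garea S) \<le> B * ?I"
    using B[unfolded stability_const_def] \<phi>(1-3) assms(2,3) immersed two_sided by blast
  moreover have "0 \<le> (\<integral>p. (\<phi> p)\<^sup>2 * (norm (nrm S p - avg_normal S \<phi>))\<^sup>2 \<partial>garea S)
        + (norm (avg_normal S \<phi>))\<^sup>2 * (\<integral>p. (\<phi> p)\<^sup>2 * (norm_A S p)\<^sup>2 \<partial>garea S)"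
    by (intro add_nonneg_nonneg mult_nonneg_nonneg Bochner_Integration.integral_nonneg) auto
  ultimately have "B * ?I \<ge> 0" by linarith
  then have "?I \<le> 0" using \<open>\<not> B \<ge> 0\<close> by (simp add: zero_le_mult_iff)
  moreover have "?I \<ge> 0" by (rule Bochner_Integration.integral_nonneg) simp
  ultimately have "?I = 0" by simp
  then have "AE p in garea S. (norm (surf_grad S \<phi> p))\<^sup>2 = 0"
    using integral_nonneg_eq_0_iff_AE[OF continuous_map_integrable[OF continuous_map_surf_grad_norm[OF sm]]]
    by simp
  then have "AE p in garea S. surf_grad S \<phi> p = 0" by simp
  then show False using AE_garea_zero[OF continuous_map_surf_grad[OF sm]] \<phi>(4) by blast
qed

text \<open>The number \<open>a\<close> depends on the cutoff and thus on \<open>c\<close>. It is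
  left existential because it is eliminated before \<open>c\<close> tends to 1/R. Nonemptiness of
  the inner part keeps the cutoff from vanishing identically.\<close>

lemma cutoff_inequality:
  assumes B: "stability_const TYPE(('m, 'n) hypersurface) B" "gaussian_cmc S" "gaussian_stable S"
    and R: "R > 0" and ball: "pos S ` topspace (surf S) \<subseteq> cball 0 (2 * R)"
    and bdry: "pos S ` surf_boundary S \<subseteq> sphere 0 (2 * R)"
    and c: "c > 1 / R" and ne: "part_in S (cball 0 R) \<noteq> {}"
  obtains a where
    "(1 - a)\<^sup>2 * measure (garea S) (part_in S (cball 0 R)) + a\<^sup>2 * (\<integral>p\<in>part_in S (cball 0 R). (norm_A S p)\<^sup>2 \<partial>garea S)
      \<le> B * (c\<^sup>2 * measure (garea S) (part_in S (cball 0 (2 * R) - cball 0 R)))"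
proof -
  let ?b = "part_in S (cball 0 R)" and ?an = "part_in S (cball 0 (2 * R) - cball 0 R)"
  have sets: "?b \<in> sets (garea S)" "?an \<in> sets (garea S)" by (intro part_in_sets; simp)+
  obtain F :: "real ^ ('n + 1) \<Rightarrow> real" and b where F: "b < 2 * R"
    "\<And>k. Ck_on k UNIV F" "\<And>x. norm x \<le> R \<Longrightarrow> F x = 1" "\<And>x. norm x \<ge> b \<Longrightarrow> F x = 0"
    "\<And>x. 0 \<le> F x" "\<And>x. F x \<le> 1" "\<And>x y. \<bar>F x - F y\<bar> \<le> c * norm (x - y)"
    using smooth_cutoff[OF R c] by metis
  have cpos: "c > 0" using R c by (meson less_trans zero_less_divide_1_iff)
  define \<phi> where "\<phi> p = F (pos S p)" for p
  have sm: "smooth_fun S \<phi>"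
    using dir_deriv_compose_pos(2)[OF F(2)] nonempty subspace_0[OF subspace_tangent_space]
    unfolding \<phi>_def by blast
  define C where "C = {p \<in> topspace (surf S). pos S p \<in> cball 0 b}"
  have C: "closedin (surf S) C"
    unfolding C_def by (rule closedin_continuous_map_preimage[OF smooth_fun_continuous_map[OF pos_smooth_fun]]) simp
  have cl: "surf S closure_of {p \<in> topspace (surf S). \<phi> p \<noteq> 0} \<subseteq> C"
    using F(4) by (intro closure_of_minimal[OF _ C]) (force simp: C_def \<phi>_def not_le less_imp_le)
  have test: "test_fun S \<phi>"
    unfolding test_fun_def
  proof (intro conjI sm)
    show "compactin (surf S) (surf S closure_of {p \<in> topspace (surf S). \<phi> p \<noteq> 0})"
      using closedin_compact_space[OF compact] by simp
    \<comment> \<open>On \<open>C\<close> the position has norm at most \<open>b\<close>, which is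
      less than 2R, while boundary points have norm exactly 2R.\<close>
    have "C \<subseteq> surf_interior S"
    proof
      fix p assume p: "p \<in> C"
      then have "p \<notin> surf_boundary S" using bdry F(1) by (auto simp: C_def)
      then show "p \<in> surf_interior S" using p by (simp add: C_def surf_boundary_def)
    qed
    then show "surf S closure_of {p \<in> topspace (surf S). \<phi> p \<noteq> 0} \<subseteq> surf_interior S"
      using cl by blast
  qed
  have one: "\<phi> p = 1" if "p \<in> ?b" for p using that F(3) by (simp add: part_in_def \<phi>_def)
  have nz: "\<exists>p\<in>topspace (surf S). \<phi> p \<noteq> 0"
    using ne one by (force simp: part_in_def)
  define v where "v = avg_normal S \<phi>"
  define a where "a = norm v"
  let ?P = "\<lambda>p. (\<phi> p)\<^sup>2 * (norm (nrm S p - v))\<^sup>2" and ?A = "\<lambda>p. (\<phi> p)\<^sup>2 * (norm_A S p)\<^sup>2"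
  have ineq: "(\<integral>p. ?P p \<partial>garea S) + a\<^sup>2 * (\<integral>p. ?A p \<partial>garea S)
      \<le> B * (\<integral>p. (norm (surf_grad S \<phi> p))\<^sup>2 \<partial>garea S)"
    using B(1)[unfolded stability_const_def] test nz F(5) B(2,3) immersed two_sided
    unfolding a_def v_def \<phi>_def by blast
  have \<phi>_cont: "continuous_map (surf S) euclideanreal \<phi>" using smooth_fun_continuous_map[OF sm] .
  have "integrable (garea S) ?P"
    by (intro continuous_map_integrable continuous_map_real_mult continuous_map_real_pow \<phi>_cont
        continuous_map_norm continuous_map_diff smooth_fun_continuous_map[OF nrm_smooth_fun]) auto
  moreover have "(1 - a)\<^sup>2 * indicator ?b p \<le> ?P p" if p: "p \<in> topspace (surf S)" for p
  proof (cases "p \<in> ?b")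
    case True
    have "\<bar>1 - a\<bar> \<le> norm (nrm S p - v)"
      using norm_triangle_ineq3[of "nrm S p" v] norm_nrm[OF p] by (simp add: a_def)
    then have "(1 - a)\<^sup>2 \<le> (norm (nrm S p - v))\<^sup>2" by (metis abs_ge_zero power2_abs power_mono)
    then show ?thesis using one[OF True] True by simp
  qed simp
  moreover have int_ind: "integrable (garea S) (\<lambda>p. C * indicator A p)" if "A \<in> sets (garea S)" for C :: real and A
    by (intro integrable_mult_right integrable_real_indicator that) (simp add: emeasure_eq_measure)
  ultimately have 1: "(\<integral>p. (1 - a)\<^sup>2 * indicator ?b p \<partial>garea S) \<le> (\<integral>p. ?P p \<partial>garea S)"
    by (intro integral_mono int_ind sets) (auto simp: space_garea)
  have A: "integrable (garea S) ?A"
    by (intro continuous_map_integrable continuous_map_real_mult continuous_map_real_pow \<phi>_cont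
        continuous_map_norm_A)
  \<comment> \<open>The cutoff equals 1 on the inner part, so inserting its square under the
    indicator changes nothing; afterwards the integral can be enlarged to the whole surface.\<close>
  have ind_A: "indicator ?b p *\<^sub>R (norm_A S p)\<^sup>2 = indicator ?b p *\<^sub>R ?A p" for p
    using one by (simp add: indicator_def)
  have "(\<integral>p\<in>?b. (norm_A S p)\<^sup>2 \<partial>garea S) \<le> (\<integral>p. ?A p \<partial>garea S)"
    unfolding set_lebesgue_integral_def ind_A
    by (intro integral_mono integrable_mult_indicator sets A) (auto simp: indicator_def)
  then have 2: "a\<^sup>2 * (\<integral>p\<in>?b. (norm_A S p)\<^sup>2 \<partial>garea S) \<le> a\<^sup>2 * (\<integral>p. ?A p \<partial>garea S)"
    by (rule mult_left_mono) simp
  have grad: "(norm (surf_grad S \<phi> p))\<^sup>2 \<le> c\<^sup>2 * indicator ?an p" if p: "p \<in> topspace (surf S)" for p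
  proof -
    have F': "(F has_derivative frechet_derivative F (at x)) (at x)" for x
      using Ck_on_derivative[OF F(2)] by auto
    have dd: "dir_deriv S w \<phi> p = frechet_derivative F (at (pos S p)) w" if "w \<in> tangent_space S p" for w
      using dir_deriv_compose_pos(1)[OF F(2) p that] by (simp add: \<phi>_def[abs_def])
    show ?thesis
    proof (cases "norm (pos S p) \<le> R")
      case True
      \<comment> \<open>\<open>F\<close> attains its maximum 1 at every point of the closed ball, so
        its differential vanishes there, the sphere of radius R included. Hence the gradient lives
        exactly over the half-open annulus.\<close>
      have "frechet_derivative F (at (pos S p)) = (\<lambda>v. 0)"
        by (rule differential_zero_maxmin[OF _ open_UNIV F']) (use F(3)[OF True] F(6) in auto)
      then have "norm (surf_grad S \<phi> p) \<le> 0"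
        by (intro norm_surf_grad_le[OF p sm]) (auto simp: dd)
      then show ?thesis by simp
    next
      case False
      then have "p \<in> ?an" using p ball by (auto simp: part_in_def)
      moreover have "norm (surf_grad S \<phi> p) \<le> c"
        using has_derivative_lipschitz_bound[OF F' F(7)] cpos
        by (intro norm_surf_grad_le[OF p sm]) (auto simp: dd)
      ultimately show ?thesis by (simp add: power_mono)
    qed
  qed
  have 3: "(\<integral>p. (norm (surf_grad S \<phi> p))\<^sup>2 \<partial>garea S) \<le> (\<integral>p. c\<^sup>2 * indicator ?an p \<partial>garea S)"
    by (intro integral_mono int_ind sets continuous_map_integrable continuous_map_surf_grad_norm sm)
      (simp add: space_garea grad)
  \<comment> \<open>The gradient integral is only bounded from above, so the estimate survives
    multiplication by \<open>B\<close> only with this sign.\<close>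
  have "B \<ge> 0" by (rule stability_const_nonneg[OF B])
  then have "B * (\<integral>p. (norm (surf_grad S \<phi> p))\<^sup>2 \<partial>garea S) \<le> B * (c\<^sup>2 * measure (garea S) ?an)"
    using 3 sets by (intro mult_left_mono) (auto simp: sets.Int_space_eq2)
  moreover have "(\<integral>p. (1 - a)\<^sup>2 * indicator ?b p \<partial>garea S) = (1 - a)\<^sup>2 * measure (garea S) ?b"
    using sets by (simp add: sets.Int_space_eq2)
  ultimately show ?thesis
    using ineq 1 2 by (intro that[of a]) linarith
qed

end

text \<open>Multiplication by q + m and completion of the square with ((q + m) a - m)^2 eliminate
  \<open>a\<close>. If q + m > 0, this says that k is at least m q/(q + m), the minimum of the
  left-hand side over \<open>a\<close>.\<close>

lemma quadratic_tradeoff: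
  fixes m q k :: real
  assumes ineq: "(1 - a)\<^sup>2 * m + a\<^sup>2 * q \<le> k" and "q + m \<ge> 0"
  shows "(q + m) * (m - k) \<le> m\<^sup>2"
proof -
  have "(q + m) * ((q + m) * a\<^sup>2 - 2 * a * m + m - k) \<le> 0"
    using assms by (intro mult_nonneg_nonpos) (auto simp: algebra_simps power2_eq_square)
  moreover have "0 \<le> ((q + m) * a - m)\<^sup>2" by simp
  ultimately show ?thesis by (simp add: algebra_simps power2_eq_square)
qed

theorem theorem5p2:
  fixes S :: "('m, 'n::finite) hypersurface" and B R :: real
  assumes "stability_const TYPE(('m, 'n) hypersurface) B"
    and "R > 0"
    and "immersed_hypersurface S" and "two_sided S"
    and "proper_map (surf S) euclidean (pos S)"
    and "pos S ` topspace (surf S) \<subseteq> cball 0 (2 * R)"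
    and "pos S ` surf_boundary S \<subseteq> sphere 0 (2 * R)"
    and "gaussian_cmc S"
    and "gaussian_stable S"
    and "measure (garea S) (part_in S (cball 0 R))
         \<ge> 2 * B / R\<^sup>2 * measure (garea S) (part_in S (cball 0 (2 * R) - cball 0 R))"
  shows "(\<integral>p\<in>part_in S (cball 0 R). (norm_A S p)\<^sup>2 \<partial>garea S)
         \<le> 2 * B / R\<^sup>2 * measure (garea S) (part_in S (cball 0 (2 * R) - cball 0 R))"
proof (cases "topspace (surf S) = {}")
  case True
  then show ?thesis by (simp add: part_in_def set_lebesgue_integral_def)
next
  case False
  \<comment> \<open>The whole surface is the preimage of the compact ball of radius 2R under the
    proper position map.\<close>
  have "compactin (surf S) {p \<in> topspace (surf S). pos S p \<in> cball 0 (2 * R)}"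
    using compactin_proper_map_preimage[OF assms(5), of "cball 0 (2 * R)"] by simp
  moreover have "{p \<in> topspace (surf S). pos S p \<in> cball 0 (2 * R)} = topspace (surf S)"
    using assms(6) by blast
  ultimately have "compact_space (surf S)" by (simp add: compact_space_def)
  then interpret compact_surface S
    using assms(3,4) False by unfold_locales
  let ?b = "part_in S (cball 0 R)" and ?an = "part_in S (cball 0 (2 * R) - cball 0 R)"
  define m where "m = measure (garea S) ?b"
  define M where "M = measure (garea S) ?an"
  define q where "q = (\<integral>p\<in>?b. (norm_A S p)\<^sup>2 \<partial>garea S)"
  define K where "K = B * ((1 / R)\<^sup>2 * M)"
  have "B \<ge> 0" by (rule stability_const_nonneg[OF assms(1,8,9)])
  then have K: "K \<ge> 0" "m \<ge> 2 * K" and goal: "2 * B / R\<^sup>2 * M = 2 * K"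
    using assms(10) by (auto simp: K_def m_def M_def power_divide)
  have q: "q \<ge> 0" unfolding q_def set_lebesgue_integral_def by (rule Bochner_Integration.integral_nonneg) simp
  have m: "m \<ge> 0" by (simp add: m_def)
  have "q \<le> 2 * K"
  \<comment> \<open>The last step divides by \<open>m\<close>. If \<open>m\<close> is zero, the
    inner part is a null set and the curvature integral over it vanishes.\<close>
  proof (cases "m = 0")
    case True
    then have "?b \<in> null_sets (garea S)"
      using part_in_sets[of "cball 0 R"] by (simp add: m_def null_sets_def emeasure_eq_measure)
    then have "AE p in garea S. p \<notin> ?b" by (rule AE_not_in)
    then have "q = 0"
      unfolding q_def set_lebesgue_integral_def
      by (intro integral_eq_zero_AE) (auto elim: eventually_mono)
    then show ?thesis using K by simp
  next
    case False
    then have "?b \<noteq> {}" by (auto simp: m_def)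
    have "(q + m) * (m - B * (c\<^sup>2 * M)) \<le> m\<^sup>2" if c: "c > 1 / R" for c
      using cutoff_inequality[OF assms(1,8,9,2,6,7) c \<open>?b \<noteq> {}\<close>] quadratic_tradeoff q m
      unfolding m_def M_def q_def by (metis add_nonneg_nonneg)
    \<comment> \<open>The inequality holds for every c > 1/R and is continuous in \<open>c\<close>,
      so it persists in the limit from the right.\<close>
    then have "\<forall>\<^sub>F c in at_right (1 / R). (q + m) * (m - B * (c\<^sup>2 * M)) \<le> m\<^sup>2"
      by (auto simp: eventually_at_filter)
    moreover have "((\<lambda>c. (q + m) * (m - B * (c\<^sup>2 * M))) \<longlongrightarrow> (q + m) * (m - K)) (at_right (1 / R))"
      unfolding K_def by (intro tendsto_intros)
    ultimately have "(q + m) * (m - K) \<le> m\<^sup>2"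
      by (intro tendsto_upperbound) auto
    then have "q * (m - K) \<le> m * K" by (simp add: algebra_simps power2_eq_square)
    \<comment> \<open>By the area hypothesis m - K is at least m/2. This lets half of m q absorb the
      term with K q, and the factor 2 in the conclusion originates here.\<close>
    moreover have "q * (m / 2) \<le> q * (m - K)" using K q by (intro mult_left_mono) auto
    ultimately have "m * q \<le> m * (2 * K)" by (simp add: algebra_simps)
    then show ?thesis using m False by simp
  qed
  then show ?thesis using goal by (simp only: q_def M_def)
qed

end
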